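(* In the non-Bayesian learning model described in the context, suppose that there is an agent $j_0\in[n]$ with $\mu_{j_0,0}(\theta^* )>0$ and that $\{A(t)\}_{t=0}^\infty$ is a deterministic $B$-connected (i.e. uniformly strongly connected) chain. Then all the agents' beliefs weakly merge to the truth $\mathbb P^*$-a.s. Also, all the agents' beliefs converge to a consensus $\mathbb P^*$-a.s., i.e. for each $\theta\in\Theta$ there exists a random variable $C_\theta\in[0,1]$ such that $\lim_{t\to\infty}\mu_{i,t}(\theta)=C_\theta$ a.s. for all $i\in[n]$. If, in addition, $\theta^*$ is identifiable, then the agents asymptotically learn $\theta^*$ $\mathbb P^*$-a.s.
   Context: Notation: $\mathbb N=\{1,2,\dots\}$, $\mathbb N_0=\mathbb N\cup\{0\}$, $[n]=\{1,\dots,n\}$. A matrix is stochastic if it is non-negative with all row sums $1$; a stochastic chain is a sequence of stochastic matrices. Model. There are $n$ agents and a finite set $\Theta$ of states, with true state $\theta^*\in\Theta$. Agent $i$ has a finite signal space $S_i$; $S:=S_1\times\cdots\times S_n$. For each $\theta\in\Theta$, $l(\cdot|\theta)$ is a probability measure on $S$ with $i$-th marginal $l_i(\cdot|\theta)$, and $l_i(s|\theta)>0$ for all $i\in[n]$, $s\in S_i$, $\theta\in\Theta$. On a probability space with measure $\mathbb P^*$ there are signals $\omega_t=(\omega_{1,t},\dots,\omega_{n,t})\in S$, $t\in\mathbb N$, i.i.d. with law $l(\cdot|\theta^* )$. Let $A(t)=(a_{ij}(t))$, $t\in\mathbb N_0$, be $n\times n$ stochastic matrices. Each agent $i$ has a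 given (non-random) prior probability measure $\mu_{i,0}$ on $\Theta$, and beliefs are updated by $$\mu_{i,t+1}(\theta)=a_{ii}(t)\,\frac{l_i(\omega_{i,t+1}|\theta)\mu_{i,t}(\theta)}{\sum_{\theta'\in\Theta}l_i(\omega_{i,t+1}|\theta')\mu_{i,t}(\theta')}+\sum_{j\ne i}a_{ij}(t)\mu_{j,t}(\theta),\qquad \theta\in\Theta,\ t\in\mathbb N_0 .$$ The $k$-step-ahead forecast of agent $i$ at time $t$ is $m^{(k)}_{i,t}(s_1,\dots,s_k):=\sum_{\theta\in\Theta}\prod_{r=1}^k l_i(s_r|\theta)\,\mu_{i,t}(\theta)$. $\Theta_i^*:=\{\theta\in\Theta: l_i(\cdot|\theta)=l_i(\cdot|\theta^* )\}$; $\theta^*$ is identifiable if $\bigcap_{j\in[n]}\Theta_j^*=\{\theta^*\}$. Along a path, the beliefs of agent $i$ weakly merge to the truth if for all $k\in\mathbb N$ and $s_1,\dots,s_k\in S_i$, $m^{(k)}_{i,t}(s_1,\dots,s_k)\to\prod_{j=1}^k l_i(s_j|\theta^* )$ as $t\to\infty$; agent $i$ asymptotically learns $\theta^*$ if $\mu_{i,t}(\theta^* )\to1$ as $t\to\infty$. Uniform strong connectivity ($B$-connectedness). A deterministic stochastic chain $\{A(t)\}_{t=0}^\infty$ is uniformly strongly connected if: (1) there is $\delta>0$ such that for all $i,j\in[n]$, $t\in\mathbb N_0$, either $a_{ij}(t)\ge\delta$ or $a_{ij}(t)=0$; (2) $a_{ii}(t)>0$ for all $i\in[n]$, $t\in\mathbb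 N_0$; (3) there is $B\in\mathbb N$ such that, with $E(t):=\{(i,j)\in[n]^2:a_{ji}(t)>0\}$, the directed graph $\big([n],\bigcup_{q=kB}^{(k+1)B-1}E(q)\big)$ is strongly connected for every $k\in\mathbb N_0$. *)

theory Defs
  imports "HOL-Probability.Probability" "Graph_Theory.Digraph_Component"
begin

text \<open>
  Agents form a finite type \<open>'n\<close> and states a finite type \<open>'th\<close>. The signal spaces \<open>S i\<close> are
  finite subsets of a common type \<open>'s\<close>, so that they may differ between agents; signal profiles
  are functions \<open>'n \<Rightarrow> 's\<close>.
\<close>

definition stochastic_matrix :: "real^'n^'n \<Rightarrow> bool" where
  "stochastic_matrix P \<longleftrightarrow> (\<forall>i j. 0 \<le> P $ i $ j) \<and> (\<forall>i. (\<Sum>j\<in>UNIV. P $ i $ j) = 1)"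

definition chain_edges :: "(nat \<Rightarrow> real^'n^'n) \<Rightarrow> nat \<Rightarrow> ('n \<times> 'n) set" where
  "chain_edges A t = {(i, j). A t $ j $ i > 0}"

definition uniformly_strongly_connected :: "(nat \<Rightarrow> real^'n^'n) \<Rightarrow> bool" where
  "uniformly_strongly_connected A \<longleftrightarrow>
     (\<exists>\<delta>>0. \<forall>i j t. A t $ i $ j \<ge> \<delta> \<or> A t $ i $ j = 0) \<and>
     (\<forall>i t. A t $ i $ i > 0) \<and>
     (\<exists>B\<ge>1. \<forall>k. strongly_connected
        (with_proj \<lparr>pverts = UNIV, parcs = (\<Union>q\<in>{k * B..<(k + 1) * B}. chain_edges A q)\<rparr>))"

definition marginal :: "('th \<Rightarrow> ('n \<Rightarrow> 's) pmf) \<Rightarrow> 'n \<Rightarrow> 'th \<Rightarrow> 's pmf" where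
  "marginal l i \<theta> = map_pmf (\<lambda>s. s i) (l \<theta>)"

text \<open>
  Beliefs along a fixed signal path \<open>w\<close>, where \<open>w t i\<close> is the signal of agent \<open>i\<close> at time
  \<open>t \<ge> 1\<close>; \<open>w 0\<close> is never used.
\<close>

primrec belief ::
  "('th::finite \<Rightarrow> ('n \<Rightarrow> 's) pmf) \<Rightarrow> (nat \<Rightarrow> real^'n^'n) \<Rightarrow> ('n \<Rightarrow> 'th pmf) \<Rightarrow>
   (nat \<Rightarrow> 'n \<Rightarrow> 's) \<Rightarrow> nat \<Rightarrow> 'n \<Rightarrow> 'th \<Rightarrow> real" where
  "belief l A \<mu>0 w 0 = (\<lambda>i \<theta>. pmf (\<mu>0 i) \<theta>)"
| "belief l A \<mu>0 w (Suc t) = (\<lambda>i \<theta>.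
     A t $ i $ i *
       (pmf (marginal l i \<theta>) (w (Suc t) i) * belief l A \<mu>0 w t i \<theta> /
        (\<Sum>\<theta>'\<in>UNIV. pmf (marginal l i \<theta>') (w (Suc t) i) * belief l A \<mu>0 w t i \<theta>'))
     + (\<Sum>j\<in>UNIV - {i}. A t $ i $ j * belief l A \<mu>0 w t j \<theta>))"

definition forecast ::
  "('th::finite \<Rightarrow> ('n \<Rightarrow> 's) pmf) \<Rightarrow> 'n \<Rightarrow> ('th \<Rightarrow> real) \<Rightarrow> nat \<Rightarrow> (nat \<Rightarrow> 's) \<Rightarrow> real" where
  "forecast l i \<mu> k s = (\<Sum>\<theta>\<in>UNIV. (\<Prod>r=1..k. pmf (marginal l i \<theta>) (s r)) * \<mu> \<theta>)"

text \<open>Here and below, \<open>\<mu> t i \<theta>\<close> is the belief trajectory along one path.\<close>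

definition weakly_merges ::
  "('n \<Rightarrow> 's set) \<Rightarrow> ('th::finite \<Rightarrow> ('n \<Rightarrow> 's) pmf) \<Rightarrow> 'th \<Rightarrow>
   (nat \<Rightarrow> 'n \<Rightarrow> 'th \<Rightarrow> real) \<Rightarrow> 'n \<Rightarrow> bool" where
  "weakly_merges S l \<theta>s \<mu> i \<longleftrightarrow>
     (\<forall>k\<ge>1. \<forall>s. (\<forall>r\<in>{1..k}. s r \<in> S i) \<longrightarrow>
        (\<lambda>t. forecast l i (\<mu> t i) k s) \<longlonglongrightarrow> (\<Prod>r=1..k. pmf (marginal l i \<theta>s) (s r)))"

definition asymptotically_learns ::
  "'th \<Rightarrow> (nat \<Rightarrow> 'n \<Rightarrow> 'th \<Rightarrow> real) \<Rightarrow> 'n \<Rightarrow> bool" where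
  "asymptotically_learns \<theta>s \<mu> i \<longleftrightarrow> (\<lambda>t. \<mu> t i \<theta>s) \<longlonglongrightarrow> 1"

definition equivalent_states :: "('th \<Rightarrow> ('n \<Rightarrow> 's) pmf) \<Rightarrow> 'th \<Rightarrow> 'n \<Rightarrow> 'th set" where
  "equivalent_states l \<theta>s i = {\<theta>. marginal l i \<theta> = marginal l i \<theta>s}"

definition identifiable :: "('th \<Rightarrow> ('n \<Rightarrow> 's) pmf) \<Rightarrow> 'th \<Rightarrow> bool" where
  "identifiable l \<theta>s \<longleftrightarrow> (\<Inter>j. equivalent_states l \<theta>s j) = {\<theta>s}"

end

theory Submission
  imports Defs
begin

text \<open>
  A uniformly strongly connected chain has an absolute probability sequence \<open>\<pi> t\<close>, bounded away
  from \<open>0\<close>, with \<open>\<pi> t = \<pi> (Suc t) A t\<close>. Write \<open>b t i\<close> for the belief of agent \<open>i\<close>. By convexity of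
  the reciprocal, \<open>\<Sum>i. \<pi> t i / b t i \<theta>s\<close> is a nonnegative supermartingale as soon as all \<open>b t i \<theta>s\<close>
  are positive; it converges, so the beliefs in the truth stay bounded away from \<open>0\<close>. On the other
  hand \<open>\<Sum>i. \<pi> t i * b t i \<theta>s\<close> is a bounded submartingale whose drift is a weighted sum of the terms
  \<open>b t i \<theta>s\<close> times the chi-squared distance between the true signal law and the one-step forecast
  of \<open>i\<close>; hence the forecasts become correct, even after every hypothetical next signal. This
  makes the two-step forecasts correct, which forces \<open>b t i \<theta>\<close> to \<open>0\<close> whenever \<open>i\<close> can tell \<open>\<theta>\<close> from
  \<open>\<theta>s\<close>, and by connectivity the same holds for all agents. For the remaining \<open>\<theta>\<close> the updates
  are asymptotically pure averaging, so the agents agree in the limit, and the submartingale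
  \<open>\<Sum>i. \<pi> t i * b t i \<theta>\<close> converges.
\<close>

text \<open>The drift of the bounded submartingale carries the factor
  \<open>b t i \<theta>s\<close>, so it says nothing about forecasts where belief in the truth
  fades; the reciprocal process is there to exclude that. Reciprocals fit because, under the true
  law, the ratio of forecast to true likelihood has mean exactly 1, while convexity absorbs the
  averaging over neighbours. Only \<open>j0\<close> is assumed to start with positive belief in the
  truth, so this process is started after \<open>T\<close> steps, when connectivity has spread that
  belief to everyone. Correct one-step forecasts do not exclude wrong states: a mixture of wrong
  signal laws can equal the true one. Correct two-step forecasts do, since then the likelihood of a
  signal, as a random variable under the belief, has second moment equal to the square of its mean.
  Simultaneous signals of different agents may be dependent. This is harmless, as each drift is a
  sum over agents of terms that involve one agent's own signal only. Conditioning on the past is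
  expressed by integrating against past events, and finite signal sets turn the next signal into a
  finite sum.\<close>

section \<open>Convergence of nonnegative supermartingales\<close>

text \<open>Doob's strategy: hold one share of \<open>X\<close> from the time it drops below \<open>a\<close> until it exceeds \<open>b\<close>.\<close>

primrec holding :: "real \<Rightarrow> real \<Rightarrow> (nat \<Rightarrow> real) \<Rightarrow> nat \<Rightarrow> bool" where
  "holding a b X 0 = (X 0 < a)"
| "holding a b X (Suc n) = (if holding a b X n then X (Suc n) \<le> b else X (Suc n) < a)"

primrec upcrossings :: "real \<Rightarrow> real \<Rightarrow> (nat \<Rightarrow> real) \<Rightarrow> nat \<Rightarrow> nat" where
  "upcrossings a b X 0 = 0"
| "upcrossings a b X (Suc n) = upcrossings a b X n + (if holding a b X n \<and> b < X (Suc n) then 1 else 0)"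

text \<open>The term for an open position makes the induction close: it is negative at the purchase,
  follows \<open>X\<close> while the share is held, and exceeds \<open>b - a\<close> at the sale,
  when it is traded for one more upcrossing.\<close>

lemma upcrossings_gain:
  "(b - a) * real (upcrossings a b X n) + (if holding a b X n then X n - a else 0)
     \<le> (\<Sum>k<n. if holding a b X k then X (Suc k) - X k else 0)"
  by (induction n) (auto simp: algebra_simps)

lemma mono_upcrossings: "mono (upcrossings a b X)"
  by (simp add: mono_iff_le_Suc)

lemma holding_if_less: "a < b \<Longrightarrow> X n < a \<Longrightarrow> holding a b X n"
  by (cases n) auto

text \<open>After any time there is a dip below \<open>a\<close>, at which the share is certainly
  held; it stays held until the first later time above \<open>b\<close>, which completes one more
  upcrossing.\<close>

lemma upcrossings_unbounded:
  assumes "a < b" and low: "\<exists>\<^sub>F n in sequentially. X n < a" and high: "\<exists>\<^sub>F n in sequentially. b < X n"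
  shows "\<exists>n. k \<le> upcrossings a b X n"
proof (induction k)
  case (Suc k)
  then obtain n where n: "k \<le> upcrossings a b X n" by blast
  obtain p where p: "p \<ge> n" "X p < a"
    using low by (auto simp: frequently_sequentially)
  obtain q0 where "q0 \<ge> p" "b < X q0"
    using high by (auto simp: frequently_sequentially)
  define q where "q = (LEAST q. q \<ge> p \<and> b < X q)"
  have q: "q \<ge> p" "b < X q"
    using LeastI[of "\<lambda>q. q \<ge> p \<and> b < X q" q0] \<open>q0 \<ge> p\<close> \<open>b < X q0\<close> unfolding q_def by auto
  have least: "X r \<le> b" if "p \<le> r" "r < q" for r
    using not_less_Least[of r "\<lambda>q. q \<ge> p \<and> b < X q"] that unfolding q_def by auto
  have hold: "holding a b X r" if "p \<le> r" "r < q" for r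
    using that
  proof (induction r rule: dec_induct)
    case base
    then show ?case using holding_if_less[of a b X p] \<open>a < b\<close> p(2) by simp
  next
    case (step r)
    then show ?case using least[of "Suc r"] by auto
  qed
  have "q \<noteq> p" using q p \<open>a < b\<close> by auto
  then obtain r where r: "q = Suc r" "p \<le> r"
    using q(1) by (metis le_neq_implies_less less_Suc_eq_le not0_implies_Suc not_less_zero)
  have "upcrossings a b X n \<le> upcrossings a b X r"
    using mono_upcrossings[of a b X] p(1) r(2) by (simp add: mono_def)
  then have "Suc k \<le> upcrossings a b X q"
    using n hold[of r] r q by simp
  then show ?case by blast
qed simp

text \<open>If liminf and limsup differed, two rationals would fit strictly between them and be
  crossed infinitely often; the recurring bound \<open>K\<close> excludes the limit infinity. Only
  rational levels occur, so that countably many null sets will suffice.\<close>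

lemma convergent_if_no_oscillation:
  fixes X :: "nat \<Rightarrow> real"
  assumes nonneg: "\<And>n. 0 \<le> X n"
    and bounded: "\<exists>\<^sub>F n in sequentially. X n \<le> K"
    and cross: "\<And>a b. a \<in> \<rat> \<Longrightarrow> b \<in> \<rat> \<Longrightarrow> a < b \<Longrightarrow>
      \<not> ((\<exists>\<^sub>F n in sequentially. X n < a) \<and> (\<exists>\<^sub>F n in sequentially. b < X n))"
  shows "convergent X"
proof -
  let ?l = "liminf (\<lambda>n. ereal (X n))" and ?u = "limsup (\<lambda>n. ereal (X n))"
  have le: "?l \<le> ?u" by (rule Liminf_le_Limsup) simp
  have "\<not> ?l < ?u"
  proof
    assume "?l < ?u"
    then obtain p where p: "?l < ereal p" "ereal p < ?u" using ereal_dense2 by blast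
    then obtain q where q: "ereal p < ereal q" "ereal q < ?u" using ereal_dense2 by blast
    then obtain s where s: "q < s" "ereal s < ?u" using ereal_dense2[of "ereal q"] by auto
    obtain a where a: "a \<in> \<rat>" "p < a" "a < q" using Rats_dense_in_real q by auto
    obtain b where b: "b \<in> \<rat>" "q < b" "b < s" using Rats_dense_in_real s by auto
    have "\<exists>\<^sub>F n in sequentially. X n < a"
    proof (rule ccontr)
      assume "\<not> ?thesis"
      then have "\<forall>\<^sub>F n in sequentially. ereal a \<le> ereal (X n)"
        by (simp add: not_frequently not_less)
      then have "ereal a \<le> ?l" by (rule Liminf_bounded)
      then show False using p(1) a by (metis ereal_less_eq(3) less_le_not_le order_trans not_less)
    qed
    moreover have "\<exists>\<^sub>F n in sequentially. b < X n"
    proof (rule ccontr)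
      assume "\<not> ?thesis"
      then have "\<forall>\<^sub>F n in sequentially. ereal (X n) \<le> ereal b"
        by (simp add: not_frequently not_less)
      then have "?u \<le> ereal b" by (rule Limsup_bounded)
      then show False using s(2) b by (metis ereal_less_eq(3) less_le_not_le order_trans not_less)
    qed
    ultimately show False using cross[of a b] a b by auto
  qed
  then have eq: "?l = ?u" using le by simp
  then have lim: "(\<lambda>n. ereal (X n)) \<longlonglongrightarrow> ?l"
    by (simp add: tendsto_iff_Liminf_eq_Limsup)
  have "0 \<le> ?l" by (rule Liminf_bounded) (simp add: nonneg)
  moreover have "?l \<le> ereal K"
  proof (rule ccontr)
    assume "\<not> ?thesis"
    then have "\<forall>\<^sub>F n in sequentially. ereal K < ereal (X n)"
      using lim by (intro order_tendstoD(1)) auto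
    then have "\<not> (\<exists>\<^sub>F n in sequentially. X n \<le> K)"
      by (simp add: not_frequently not_le)
    then show False using bounded by simp
  qed
  ultimately obtain r where "?l = ereal r" by (cases ?l) auto
  then show ?thesis using lim by (auto simp: convergent_def)
qed

lemma measurable_holding:
  assumes mono: "\<And>n. sets (F n) \<subseteq> sets (F (Suc n))" and space: "\<And>n. space (F n) = space N"
    and X: "\<And>n. X n \<in> borel_measurable (F n)"
  shows "{x \<in> space N. holding a b (\<lambda>n. X n x) n} \<in> sets (F n)"
proof (induction n)
  case 0
  show ?case using X[of 0] by (simp add: space[of 0, symmetric])
next
  case (Suc n)
  let ?H = "{x \<in> space N. holding a b (\<lambda>n. X n x) n}"
  have [measurable]: "X (Suc n) \<in> borel_measurable (F (Suc n))" by (rule X)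
  have [measurable]: "?H \<in> sets (F (Suc n))" using Suc mono by blast
  have "{x \<in> space N. holding a b (\<lambda>n. X n x) (Suc n)} =
      {x \<in> space (F (Suc n)). if x \<in> ?H then X (Suc n) x \<le> b else X (Suc n) x < a}"
    by (auto simp: space)
  also have "\<dots> \<in> sets (F (Suc n))" by measurable
  finally show ?case .
qed

text \<open>\<open>super\<close> is the supermartingale inequality tested on events of
  \<open>F n\<close>. This is the form that Doob's argument consumes, because the strategy holds the
  share between \<open>n\<close> and \<open>Suc n\<close> on such an event.\<close>

theorem (in prob_space) nonneg_supermartingale_convergent:
  fixes X :: "nat \<Rightarrow> 'a \<Rightarrow> real"
  assumes sub: "\<And>n. subalgebra M (F n)" and mono: "\<And>n. sets (F n) \<subseteq> sets (F (Suc n))"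
    and X: "\<And>n. X n \<in> borel_measurable (F n)"
    and int: "\<And>n. integrable M (X n)"
    and nonneg: "\<And>n x. x \<in> space M \<Longrightarrow> 0 \<le> X n x"
    and super: "\<And>n H. H \<in> sets (F n) \<Longrightarrow> (\<integral>x. indicator H x * X (Suc n) x \<partial>M) \<le> (\<integral>x. indicator H x * X n x \<partial>M)"
  shows "AE x in M. convergent (\<lambda>n. X n x)"
proof -
  have space: "space (F n) = space M" and sets: "sets (F n) \<subseteq> sets M" for n
    using sub[of n] by (auto simp: subalgebra_def)
  have XM [measurable]: "X n \<in> borel_measurable M" for n
    using X sub measurable_from_subalg by blast
  have indH: "integrable M (\<lambda>x. indicator H x * X m x)" if "H \<in> sets M" for H m
    using that int[of m] integrable_real_mult_indicator[of H M "X m"] by (simp add: mult.commute)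
  have "AE x in M. \<not> ((\<exists>\<^sub>F n in sequentially. X n x < a) \<and> (\<exists>\<^sub>F n in sequentially. b < X n x))"
    if "a < b" for a b
  proof -
    define H where "H n = {x \<in> space M. holding a b (\<lambda>n. X n x) n}" for n
    have HF: "H n \<in> sets (F n)" for n
      unfolding H_def by (rule measurable_holding) (use mono space X in auto)
    then have HM [measurable]: "H n \<in> sets M" for n using sets by blast
    define U where "U n x = real (upcrossings a b (\<lambda>n. X n x) n)" for n x
    have U_Suc: "U (Suc n) x = U n x + (if x \<in> H n \<and> b < X (Suc n) x then 1 else 0)"
      if "x \<in> space M" for n x using that by (simp add: U_def H_def)
    have UM [measurable]: "U n \<in> borel_measurable M" for n
    proof (induction n)
      case 0 then show ?case by (simp add: U_def)
    next
      case (Suc n)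
      then have "(\<lambda>x. U n x + (if x \<in> H n \<and> b < X (Suc n) x then 1 else 0)) \<in> borel_measurable M"
        by measurable
      then show ?case using U_Suc by (subst measurable_cong) auto
    qed
    have U_le: "U n x \<le> real n" for n x
      by (induction n) (auto simp: U_def)
    have U_nonneg: "0 \<le> U n x" for n x by (simp add: U_def)
    have U_int: "integrable M (U n)" for n
      by (rule integrable_const_bound[where B="real n"]) (use U_le U_nonneg in \<open>auto intro!: AE_I2\<close>)
    \<comment> \<open>An open position is worth at least \<open>- \<bar>a\<bar>\<close> because
      \<open>X\<close> is nonnegative, and every trading increment has nonpositive mean by
      \<open>super\<close>.\<close>
    have U_bound: "(b - a) * (\<integral>x. U n x \<partial>M) \<le> \<bar>a\<bar>" for n
    proof -
      have "(b - a) * U n x - \<bar>a\<bar> \<le> (\<Sum>k<n. indicator (H k) x * X (Suc k) x - indicator (H k) x * X k x)"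
        if x: "x \<in> space M" for x
      proof -
        have "(b - a) * U n x - \<bar>a\<bar> \<le> (b - a) * U n x + (if holding a b (\<lambda>n. X n x) n then X n x - a else 0)"
          using nonneg[OF x, of n] by auto
        also have "\<dots> \<le> (\<Sum>k<n. if holding a b (\<lambda>n. X n x) k then X (Suc k) x - X k x else 0)"
          unfolding U_def using upcrossings_gain[of b a "\<lambda>n. X n x" n] .
        also have "\<dots> = (\<Sum>k<n. indicator (H k) x * X (Suc k) x - indicator (H k) x * X k x)"
          using x by (intro sum.cong) (auto simp: H_def)
        finally show ?thesis .
      qed
      then have "(\<integral>x. (b - a) * U n x - \<bar>a\<bar> \<partial>M) \<le>
          (\<integral>x. (\<Sum>k<n. indicator (H k) x * X (Suc k) x - indicator (H k) x * X k x) \<partial>M)"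
        by (intro integral_mono Bochner_Integration.integrable_sum Bochner_Integration.integrable_diff
            integrable_mult_right indH U_int) auto
      also have "\<dots> = (\<Sum>k<n. (\<integral>x. indicator (H k) x * X (Suc k) x \<partial>M) - (\<integral>x. indicator (H k) x * X k x \<partial>M))"
        by (subst Bochner_Integration.integral_sum) (auto intro!: indH sum.cong Bochner_Integration.integral_diff)
      also have "\<dots> \<le> 0"
        by (intro sum_nonpos) (use super HF in auto)
      finally show ?thesis
        using U_int[of n] by (simp add: prob_space)
    qed
    have "(\<integral>\<^sup>+x. (SUP n. ennreal (U n x)) \<partial>M) = (SUP n. \<integral>\<^sup>+x. ennreal (U n x) \<partial>M)"
    proof (rule nn_integral_monotone_convergence_SUP)
      show "incseq (\<lambda>n x. ennreal (U n x))"
        by (auto simp: incseq_def le_fun_def U_def intro!: ennreal_leI monoD[OF mono_upcrossings])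
    qed simp
    also have "\<dots> \<le> ennreal (\<bar>a\<bar> / (b - a))"
    proof (rule SUP_least)
      fix n
      have "(\<integral>\<^sup>+x. ennreal (U n x) \<partial>M) = ennreal (\<integral>x. U n x \<partial>M)"
        by (rule nn_integral_eq_integral) (use U_int U_nonneg in auto)
      also have "\<dots> \<le> ennreal (\<bar>a\<bar> / (b - a))"
        using U_bound[of n] \<open>a < b\<close> by (intro ennreal_leI) (simp add: field_simps)
      finally show "(\<integral>\<^sup>+x. ennreal (U n x) \<partial>M) \<le> ennreal (\<bar>a\<bar> / (b - a))" .
    qed
    finally have "(\<integral>\<^sup>+x. (SUP n. ennreal (U n x)) \<partial>M) \<noteq> \<infinity>"
      using neq_top_trans by force
    then have "AE x in M. (SUP n. ennreal (U n x)) \<noteq> \<infinity>"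
      by (intro nn_integral_PInf_AE) auto
    then show ?thesis
    proof eventually_elim
      case (elim x)
      show ?case
      proof
        assume freq: "(\<exists>\<^sub>F n in sequentially. X n x < a) \<and> (\<exists>\<^sub>F n in sequentially. b < X n x)"
        obtain k :: nat where k: "(SUP n. ennreal (U n x)) < of_nat k"
          using elim ennreal_Ex_less_of_nat[of "SUP n. ennreal (U n x)"] unfolding infinity_ennreal_def less_top by blast
        obtain n where "k \<le> upcrossings a b (\<lambda>n. X n x) n"
          using upcrossings_unbounded[OF \<open>a < b\<close>, of "\<lambda>n. X n x" k] freq by blast
        then have "of_nat k \<le> ennreal (U n x)"
          by (simp add: U_def ennreal_of_nat_eq_real_of_nat ennreal_leI)
        also have "\<dots> \<le> (SUP n. ennreal (U n x))" by (rule SUP_upper) simp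
        finally show False using k by simp
      qed
    qed
  qed
  then have cross: "AE x in M. \<forall>a\<in>\<rat>. \<forall>b\<in>\<rat>. a < b \<longrightarrow>
      \<not> ((\<exists>\<^sub>F n in sequentially. X n x < a) \<and> (\<exists>\<^sub>F n in sequentially. b < X n x))"
    by (auto simp: AE_ball_countable countable_rat)
  have EX: "(\<integral>x. X n x \<partial>M) \<le> (\<integral>x. X 0 x \<partial>M)" for n
  proof (induction n)
    case (Suc n)
    have "(\<integral>x. X m x \<partial>M) = (\<integral>x. indicator (space M) x * X m x \<partial>M)" for m
      by (intro Bochner_Integration.integral_cong) auto
    then show ?case using Suc super[of "space M" n] sets.top[of "F n"] by (simp add: space)
  qed simp
  \<comment> \<open>Fatou's lemma with bounded means makes the liminf finite almost everywhere,
    which excludes divergence to infinity.\<close>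
  have "(\<integral>\<^sup>+x. liminf (\<lambda>n. ennreal (X n x)) \<partial>M) \<le> liminf (\<lambda>n. \<integral>\<^sup>+x. ennreal (X n x) \<partial>M)"
    by (rule nn_integral_liminf) simp
  also have "\<dots> \<le> ennreal (\<integral>x. X 0 x \<partial>M)"
  proof -
    have "(\<integral>\<^sup>+x. ennreal (X n x) \<partial>M) \<le> ennreal (\<integral>x. X 0 x \<partial>M)" for n
      using EX[of n] by (subst nn_integral_eq_integral) (auto intro!: int AE_I2 nonneg ennreal_leI)
    then have "liminf (\<lambda>n. \<integral>\<^sup>+x. ennreal (X n x) \<partial>M) \<le> liminf (\<lambda>n. ennreal (\<integral>x. X 0 x \<partial>M))"
      by (intro Liminf_mono) simp
    then show ?thesis by (simp add: Liminf_const)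
  qed
  finally have "(\<integral>\<^sup>+x. liminf (\<lambda>n. ennreal (X n x)) \<partial>M) \<noteq> \<infinity>"
    using neq_top_trans by force
  then have "AE x in M. liminf (\<lambda>n. ennreal (X n x)) \<noteq> \<infinity>"
    by (intro nn_integral_PInf_AE) auto
  with cross show ?thesis
    using AE_space
  proof eventually_elim
    case (elim x)
    obtain k :: nat where k: "liminf (\<lambda>n. ennreal (X n x)) < of_nat k"
      using elim(2) ennreal_Ex_less_of_nat[of "liminf (\<lambda>n. ennreal (X n x))"] unfolding infinity_ennreal_def less_top by blast
    have "\<exists>\<^sub>F n in sequentially. X n x \<le> real k"
    proof (rule ccontr)
      assume "\<not> ?thesis"
      then have "\<forall>\<^sub>F n in sequentially. real k < X n x" by (simp add: not_frequently not_le)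
      then have "\<forall>\<^sub>F n in sequentially. of_nat k \<le> ennreal (X n x)"
        by eventually_elim (simp add: ennreal_of_nat_eq_real_of_nat ennreal_leI)
      then have "of_nat k \<le> liminf (\<lambda>n. ennreal (X n x))" by (rule Liminf_bounded)
      then show False using k by simp
    qed
    then show ?case
      using elim(1) nonneg[OF elim(3)] by (intro convergent_if_no_oscillation) auto
  qed
qed

section \<open>Uniformly strongly connected chains\<close>

text \<open>Once \<open>e\<close> stays below \<open>\<eta> * r\<close>, the recursion is dominated
  by an affine contraction with fixed point \<open>r\<close>, approached geometrically along steps
  of length \<open>T\<close>.\<close>

lemma contraction_tendsto_0:
  fixes v :: "nat \<Rightarrow> real"
  assumes "0 < \<eta>" "\<eta> \<le> 1" and v: "\<And>t. 0 \<le> v t" "\<And>t. v t \<le> K"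
    and step: "\<And>t. v (t + T) \<le> (1 - \<eta>) * v t + e t" and e: "e \<longlonglongrightarrow> 0"
  shows "v \<longlonglongrightarrow> 0"
proof (rule tendstoI)
  fix \<epsilon> :: real assume "0 < \<epsilon>"
  define r where "r = \<epsilon> / 2"
  have "0 < r" using \<open>0 < \<epsilon>\<close> by (simp add: r_def)
  have "0 \<le> K" using v order_trans by blast
  have "\<forall>\<^sub>F t in sequentially. e t < \<eta> * r"
    using e \<open>0 < \<eta>\<close> \<open>0 < r\<close> by (intro order_tendstoD) auto
  then obtain N where N: "e t < \<eta> * r" if "t \<ge> N" for t
    by (auto simp: eventually_sequentially)
  have iter: "v (t + k * T) \<le> r + (1 - \<eta>) ^ k * K" if "t \<ge> N" for t k
  proof (induction k)
    case 0
    then show ?case using v(2)[of t] \<open>0 < r\<close> by simp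
  next
    case (Suc k)
    have "v (t + Suc k * T) \<le> (1 - \<eta>) * v (t + k * T) + e (t + k * T)"
      using step[of "t + k * T"] by (simp add: algebra_simps)
    also have "\<dots> \<le> (1 - \<eta>) * (r + (1 - \<eta>) ^ k * K) + \<eta> * r"
      using Suc N[of "t + k * T"] that \<open>\<eta> \<le> 1\<close> by (intro add_mono mult_left_mono) auto
    finally show ?case by (simp add: algebra_simps)
  qed
  have "(\<lambda>k. (1 - \<eta>) ^ k * K) \<longlonglongrightarrow> 0"
    using \<open>0 < \<eta>\<close> \<open>\<eta> \<le> 1\<close> by (intro tendsto_mult_left_zero LIMSEQ_power_zero) auto
  then have "\<forall>\<^sub>F k in sequentially. (1 - \<eta>) ^ k * K < r"
    using \<open>0 < r\<close> by (rule order_tendstoD)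
  then obtain k where k: "(1 - \<eta>) ^ k * K < r" by (auto simp: eventually_sequentially)
  have "v t < \<epsilon>" if "t \<ge> N + k * T" for t
    using iter[of "t - k * T" k] k that unfolding r_def by (simp add: le_diff_conv2)
  then show "\<forall>\<^sub>F t in sequentially. dist (v t) 0 < \<epsilon>"
    using v(1) by (auto simp: eventually_sequentially dist_real_def)
qed

locale connected_chain =
  fixes A :: "nat \<Rightarrow> real^'n::finite^'n"
  assumes stochastic: "\<And>t. stochastic_matrix (A t)"
    and connected: "uniformly_strongly_connected A"
begin

lemma A_nonneg [simp]: "0 \<le> A t $ i $ j"
  using stochastic by (simp add: stochastic_matrix_def)

lemma A_row_sum [simp]: "(\<Sum>j\<in>UNIV. A t $ i $ j) = 1"
  using stochastic by (simp add: stochastic_matrix_def)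

lemma A_le_1 [simp]: "A t $ i $ j \<le> 1"
  using member_le_sum[of j UNIV "\<lambda>j. A t $ i $ j"] by simp

lemma entry_bound:
  obtains \<delta> where "0 < \<delta>" "\<delta> \<le> 1" "\<And>t i j. 0 < A t $ i $ j \<Longrightarrow> \<delta> \<le> A t $ i $ j"
    "\<And>t i. \<delta> \<le> A t $ i $ i"
proof -
  obtain \<delta> where \<delta>: "0 < \<delta>" "\<forall>i j t. A t $ i $ j \<ge> \<delta> \<or> A t $ i $ j = 0"
    and diag: "\<forall>i t. A t $ i $ i > 0"
    using connected by (auto simp: uniformly_strongly_connected_def)
  show thesis
  proof
    show pos: "\<delta> \<le> A t $ i $ j" if "0 < A t $ i $ j" for t i j using that \<delta>(2) by force
    then show "\<delta> \<le> A t $ i $ i" for t i using diag by blast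
    then show "\<delta> \<le> 1" using A_le_1 order_trans by blast
  qed (fact \<delta>(1))
qed

text \<open>Strong connectivity is used through cuts: if no edge of the block left \<open>R\<close>,
  no vertex outside \<open>R\<close> would be reachable from inside. An edge from \<open>i\<close>
  to \<open>j\<close> means that \<open>j\<close> listens to \<open>i\<close>.\<close>

lemma block_length:
  obtains B where "1 \<le> B"
    "\<And>k R. R \<noteq> {} \<Longrightarrow> R \<noteq> UNIV \<Longrightarrow> \<exists>q\<in>{k * B..<(k + 1) * B}. \<exists>i\<in>R. \<exists>j. j \<notin> R \<and> 0 < A q $ j $ i"
proof -
  obtain B where B: "1 \<le> B" "\<forall>k. strongly_connected
        (with_proj \<lparr>pverts = UNIV, parcs = (\<Union>q\<in>{k * B..<(k + 1) * B}. chain_edges A q)\<rparr>)"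
    using connected by (auto simp: uniformly_strongly_connected_def)
  show thesis
  proof
    fix k and R :: "'n set" assume "R \<noteq> {}" "R \<noteq> UNIV"
    then obtain u v where uv: "u \<in> R" "v \<notin> R" by blast
    define E where "E = (\<Union>q\<in>{k * B..<(k + 1) * B}. chain_edges A q)"
    have "(u, v) \<in> rtrancl_on UNIV E"
      using B(2)[rule_format, of k] by (simp add: strongly_connected_def reachable_def E_def)
    moreover have "w \<in> R" if "(u, w) \<in> rtrancl_on UNIV E" "E `` R \<subseteq> R" for w
      using that(1) by (induction rule: rtrancl_on_induct) (use uv that(2) in auto)
    ultimately have "\<not> E `` R \<subseteq> R" using uv by blast
    then show "\<exists>q\<in>{k * B..<(k + 1) * B}. \<exists>i\<in>R. \<exists>j. j \<notin> R \<and> 0 < A q $ j $ i"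
      by (auto simp: E_def chain_edges_def)
  qed (fact B(1))
qed

text \<open>The agents that still own a share \<open>\<kappa> ^ (t - s)\<close> of
  \<open>y s j\<close> form a growing set: self-loops keep its members, and each block adds an agent
  across the cut until all belong. Asking for an inequality with loss factor \<open>c\<close> covers
  both pure averaging (\<open>c = 1\<close>) and Bayesian updates (\<open>c\<close> a lower bound
  for likelihoods). The constants are uniform in the start time and in \<open>y\<close>.\<close>

lemma propagation:
  fixes c :: real
  assumes "0 < c" "c \<le> 1"
  obtains \<eta> T where "0 < \<eta>" "\<eta> \<le> 1"
    "\<And>y s i j. (\<And>i. 0 \<le> y s i) \<Longrightarrow>
       (\<And>t i. s \<le> t \<Longrightarrow> c * (\<Sum>j\<in>UNIV. A t $ i $ j * y t j) \<le> y (Suc t) i) \<Longrightarrow>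
       \<eta> * y s j \<le> y (s + T) i"
proof -
  obtain \<delta> where \<delta>: "0 < \<delta>" "\<delta> \<le> 1" "\<And>t i j. 0 < A t $ i $ j \<Longrightarrow> \<delta> \<le> A t $ i $ j"
    "\<And>t i. \<delta> \<le> A t $ i $ i" by (fact entry_bound)
  obtain B where B: "1 \<le> B"
    "\<And>k R. R \<noteq> {} \<Longrightarrow> R \<noteq> UNIV \<Longrightarrow> \<exists>q\<in>{k * B..<(k + 1) * B}. \<exists>i\<in>R. \<exists>j. j \<notin> R \<and> 0 < A q $ j $ i"
    by (fact block_length)
  \<comment> \<open>At most \<open>CARD('n)\<close> full blocks are needed, and one more block
    length covers a start \<open>s\<close> in the middle of a block.\<close>
  define T where "T = (CARD('n) + 1) * B"
  define \<kappa> where "\<kappa> = c * \<delta>"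
  have \<kappa>: "0 < \<kappa>" "\<kappa> \<le> 1" using assms \<delta> by (auto simp: \<kappa>_def mult_le_one)
  show thesis
  proof
    show "0 < \<kappa> ^ T" "\<kappa> ^ T \<le> 1" using \<kappa> by (auto simp: power_le_one)
    fix y :: "nat \<Rightarrow> 'n \<Rightarrow> real" and s i j
    assume nonneg: "\<And>i. 0 \<le> y s i"
      and y_Suc: "\<And>t i. s \<le> t \<Longrightarrow> c * (\<Sum>j\<in>UNIV. A t $ i $ j * y t j) \<le> y (Suc t) i"
    have y0: "0 \<le> y t i" if "s \<le> t" for t i
      using that
    proof (induction t arbitrary: i rule: dec_induct)
      case (step t)
      have "0 \<le> c * (\<Sum>j\<in>UNIV. A t $ i $ j * y t j)"
        using \<open>0 < c\<close> step by (intro mult_nonneg_nonneg sum_nonneg) auto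
      then show ?case using y_Suc[of t i] step by linarith
    qed (rule nonneg)
    have edge: "\<kappa> * y t i \<le> y (Suc t) k" if "s \<le> t" "\<delta> \<le> A t $ k $ i" for t i k
    proof -
      have "\<delta> * y t i \<le> A t $ k $ i * y t i" using that y0 by (intro mult_right_mono) auto
      also have "\<dots> \<le> (\<Sum>j\<in>UNIV. A t $ k $ j * y t j)"
        using y0 that by (intro member_le_sum) auto
      finally have "c * (\<delta> * y t i) \<le> c * (\<Sum>j\<in>UNIV. A t $ k $ j * y t j)"
        using \<open>0 < c\<close> by simp
      also have "\<dots> \<le> y (Suc t) k" using y_Suc that by blast
      finally show ?thesis by (simp add: \<kappa>_def mult.assoc)
    qed
    define R where "R t = {i. \<kappa> ^ (t - s) * y s j \<le> y t i}" for t
    have R_edge: "k \<in> R (Suc t)" if "i \<in> R t" "s \<le> t" "\<delta> \<le> A t $ k $ i" for i k t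
    proof -
      have "\<kappa> ^ (Suc t - s) * y s j = \<kappa> * (\<kappa> ^ (t - s) * y s j)"
        using that(2) by (simp add: Suc_diff_le)
      also have "\<dots> \<le> \<kappa> * y t i" using that(1) \<kappa> by (simp add: R_def)
      also have "\<dots> \<le> y (Suc t) k" using edge that by blast
      finally show ?thesis by (simp add: R_def)
    qed
    have R_mono: "R t \<subseteq> R t'" if "s \<le> t" "t \<le> t'" for t t'
      using that(2)
    proof (induction t' rule: dec_induct)
      case (step t')
      then show ?case using R_edge[OF _ _ \<delta>(4)] that(1) by (meson order_trans subset_iff)
    qed simp
    \<comment> \<open>Division rounded up: block \<open>k0\<close> is the first one that begins at
      or after \<open>s\<close>.\<close>
    define k0 where "k0 = (s + B - 1) div B"
    have k0: "s \<le> k0 * B" "k0 * B \<le> s + B"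
    proof -
      have "k0 * B + (s + B - 1) mod B = s + B - 1" by (simp add: k0_def)
      moreover have "(s + B - 1) mod B < B" using B(1) by simp
      ultimately show "s \<le> k0 * B" "k0 * B \<le> s + B" by linarith+
    qed
    have "j \<in> R s" by (simp add: R_def)
    have grow: "k < card (R ((k0 + k) * B)) \<or> R ((k0 + k) * B) = UNIV" for k
    proof (induction k)
      case 0
      have "j \<in> R (k0 * B)" using R_mono[of s "k0 * B"] k0 \<open>j \<in> R s\<close> by auto
      then show ?case by (auto simp: card_gt_0_iff)
    next
      case (Suc k)
      let ?R = "R ((k0 + k) * B)" and ?R' = "R ((k0 + Suc k) * B)"
      have s_le: "s \<le> (k0 + k) * B" using k0(1) by (simp add: add_mult_distrib)
      have sub: "?R \<subseteq> ?R'" by (rule R_mono[OF s_le]) simp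
      show ?case
      proof (cases "?R = UNIV")
        case True
        then show ?thesis using sub by auto
      next
        case False
        have "j \<in> ?R" using R_mono[of s "(k0 + k) * B"] s_le \<open>j \<in> R s\<close> by auto
        then obtain q i l where q: "q \<in> {(k0 + k) * B..<(k0 + k + 1) * B}" "i \<in> ?R" "l \<notin> ?R" "0 < A q $ l $ i"
          using B(2)[of ?R "k0 + k"] False by blast
        have "i \<in> R q" using R_mono[OF s_le, of q] q by auto
        then have "l \<in> R (Suc q)" using R_edge[of i q l] q \<delta>(3) s_le by auto
        then have "l \<in> ?R'" using R_mono[of "Suc q" "(k0 + Suc k) * B"] q s_le by auto
        then have "card ?R < card ?R'" using q(3) sub by (intro psubset_card_mono) auto
        then show ?thesis using Suc False by auto
      qed
    qed
    have "R ((k0 + CARD('n)) * B) = UNIV"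
      using grow[of "CARD('n)"] card_mono[of UNIV "R ((k0 + CARD('n)) * B)"] by auto
    moreover have "R ((k0 + CARD('n)) * B) \<subseteq> R (s + T)"
      using k0 by (intro R_mono) (auto simp: T_def algebra_simps)
    ultimately show "\<kappa> ^ T * y s j \<le> y (s + T) i" by (auto simp: R_def)
  qed
qed

text \<open>The spread between the largest and the smallest entry contracts by
  \<open>1 - \<eta>\<close> every \<open>T\<close> steps, up to the noise accumulated
  meanwhile.\<close>

lemma consensus:
  assumes bounded: "\<And>t i. \<bar>x t i\<bar> \<le> K"
    and noise: "\<And>t i. \<bar>x (Suc t) i - (\<Sum>j\<in>UNIV. A t $ i $ j * x t j)\<bar> \<le> e t" and e: "e \<longlonglongrightarrow> 0"
  shows "(\<lambda>t. x t i - x t j) \<longlonglongrightarrow> 0"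
proof -
  obtain \<eta> T where \<eta>: "0 < \<eta>" "\<eta> \<le> 1" and reach:
    "\<And>y s i j. (\<And>i. 0 \<le> y s i) \<Longrightarrow>
       (\<And>t i. s \<le> t \<Longrightarrow> 1 * (\<Sum>j\<in>UNIV. A t $ i $ j * y t j) \<le> y (Suc t) i) \<Longrightarrow>
       \<eta> * y s j \<le> y (s + T) i"
    by (fact propagation[OF zero_less_one order_refl])
  \<comment> \<open>Measured from a ceiling that rises with the accumulated noise, the gaps
    \<open>m + (\<Sum>r=s..<t. e r) - x' t i\<close> satisfy the one-sided recursion of
    \<open>propagation\<close>; so the gap of any agent \<open>j\<close> pulls all agents below the
    ceiling.\<close>
  have bound: "\<eta> * (m - x' s j) \<le> m + (\<Sum>r=s..<s+T. e r) - x' (s + T) i"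
    if m: "\<And>i. x' s i \<le> m"
      and x': "\<And>t i. \<bar>x' (Suc t) i - (\<Sum>j\<in>UNIV. A t $ i $ j * x' t j)\<bar> \<le> e t" for x' s m i j
  proof -
    have "\<eta> * (m + (\<Sum>r=s..<s. e r) - x' s j) \<le> m + (\<Sum>r=s..<s+T. e r) - x' (s + T) i"
    proof (rule reach[of "\<lambda>t i. m + (\<Sum>r=s..<t. e r) - x' t i" s])
      fix t i assume "s \<le> t"
      have "(\<Sum>j\<in>UNIV. A t $ i $ j * (m + (\<Sum>r=s..<t. e r) - x' t j)) =
          (m + (\<Sum>r=s..<t. e r)) - (\<Sum>j\<in>UNIV. A t $ i $ j * x' t j)"
        by (simp add: right_diff_distrib sum_subtractf flip: sum_distrib_right)
      then show "1 * (\<Sum>j\<in>UNIV. A t $ i $ j * (m + (\<Sum>r=s..<t. e r) - x' t j)) \<le> m + (\<Sum>r=s..<Suc t. e r) - x' (Suc t) i"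
        using x'[of t i] \<open>s \<le> t\<close> by simp
    qed (simp add: m)
    then show ?thesis by simp
  qed
  define hi where "hi t = Max (range (x t))" for t
  define lo where "lo t = Min (range (x t))" for t
  have hi: "x t i \<le> hi t" and lo: "lo t \<le> x t i" for t i by (auto simp: hi_def lo_def)
  have hi_in: "hi t \<in> range (x t)" and lo_in: "lo t \<in> range (x t)" for t
    unfolding hi_def lo_def by (intro Max_in Min_in; simp)+
  define e' where "e' t = 2 * (\<Sum>r<T. e (t + r))" for t
  have sum_eq: "(\<Sum>r=t..<t+T. e r) = (\<Sum>r<T. e (t + r))" for t
    using sum.shift_bounds_nat_ivl[of e 0 t T] by (simp add: add.commute lessThan_atLeast0)
  have "(\<lambda>t. hi t - lo t) \<longlonglongrightarrow> 0"
  proof (rule contraction_tendsto_0[OF \<eta>])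
    show "0 \<le> hi t - lo t" for t using hi[of t undefined] lo[of t undefined] by linarith
    show "hi t - lo t \<le> 2 * K" for t
    proof -
      obtain p q where "hi t = x t p" "lo t = x t q" using hi_in lo_in by blast
      then show ?thesis using bounded[of t p] bounded[of t q] by linarith
    qed
    have "(\<lambda>t. e (t + r)) \<longlonglongrightarrow> 0" for r using e LIMSEQ_ignore_initial_segment by blast
    then show "e' \<longlonglongrightarrow> 0" unfolding e'_def by (intro tendsto_mult_right_zero tendsto_null_sum)
    fix t
    obtain j where j: "lo t = x t j" using lo_in by blast
    obtain p q where p: "hi (t + T) = x (t + T) p" and q: "lo (t + T) = x (t + T) q"
      using lo_in hi_in by blast
    have "\<eta> * (hi t - x t j) \<le> hi t + (\<Sum>r=t..<t+T. e r) - x (t + T) p"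
      by (rule bound) (use hi noise in auto)
    \<comment> \<open>As \<open>j\<close> attains the minimum, the left side is 0. Only the top
      contracts; the bottom drops by at most the noise, hence the factor 2 in
      \<open>e'\<close>.\<close>
    moreover have "\<eta> * (- lo t - - x t j) \<le> - lo t + (\<Sum>r=t..<t+T. e r) - - x (t + T) q"
    proof (rule bound[of "\<lambda>t i. - x t i"])
      show "- x t i \<le> - lo t" for i using lo by simp
      show "\<bar>- x (Suc t) i - (\<Sum>j\<in>UNIV. A t $ i $ j * - x t j)\<bar> \<le> e t" for t i
        using noise[of t i] by (simp add: sum_negf)
    qed
    ultimately show "hi (t + T) - lo (t + T) \<le> (1 - \<eta>) * (hi t - lo t) + e' t"
      unfolding e'_def sum_eq p q j by (simp add: algebra_simps)
  qed
  then show ?thesis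
  proof (rule Lim_null_comparison[rotated])
    have "norm (x t i - x t j) \<le> hi t - lo t" for t
      using hi[of t i] lo[of t i] hi[of t j] lo[of t j] by auto
    then show "\<forall>\<^sub>F t in sequentially. norm (x t i - x t j) \<le> hi t - lo t" by simp
  qed
qed

text \<open>Kolmogorov's absolute probability sequence: \<open>\<pi> s\<close> is the common limit, as \<open>k\<close> grows, of the
  rows of \<open>A (s + k - 1) ** \<dots> ** A s\<close>.\<close>

lemma absolute_probability_sequence:
  obtains p \<pi> where "0 < p" "\<And>t i. p \<le> \<pi> t i" "\<And>t. (\<Sum>i\<in>UNIV. \<pi> t i) = 1"
    "\<And>t j. \<pi> t j = (\<Sum>i\<in>UNIV. \<pi> (Suc t) i * A t $ i $ j)"
proof -
  obtain \<eta> T where \<eta>: "0 < \<eta>" "\<eta> \<le> 1" and reach: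
    "\<And>y s i j. (\<And>i. 0 \<le> y s i) \<Longrightarrow>
       (\<And>t i. s \<le> t \<Longrightarrow> 1 * (\<Sum>j\<in>UNIV. A t $ i $ j * y t j) \<le> y (Suc t) i) \<Longrightarrow>
       \<eta> * y s j \<le> y (s + T) i"
    by (fact propagation[OF zero_less_one order_refl])
  define Q where "Q s = rec_nat (mat 1) (\<lambda>k P. A (s + k) ** P)" for s
  have Q_0: "Q s 0 = mat 1" and Q_Suc: "Q s (Suc k) = A (s + k) ** Q s k" for s k
    by (simp_all add: Q_def)
  \<comment> \<open>Splitting off the earliest factor instead of the latest; in the limit this
    becomes the recursion for \<open>\<pi>\<close>.\<close>
  have Q_shift: "Q s (Suc k) = Q (Suc s) k ** A s" for s k
    by (induction k) (simp_all add: Q_0 Q_Suc matrix_mul_assoc)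
  have Q_step: "Q s (Suc k) $ i $ j = (\<Sum>r\<in>UNIV. A (s + k) $ i $ r * Q s k $ r $ j)" for s k i j
    by (simp add: Q_Suc matrix_matrix_mult_def)
  have Q_bounds: "0 \<le> Q s k $ i $ j \<and> Q s k $ i $ j \<le> 1" for s k i j
  proof (induction k arbitrary: i)
    case 0 then show ?case by (simp add: Q_0 mat_def)
  next
    case (Suc k)
    have "(\<Sum>r\<in>UNIV. A (s + k) $ i $ r * Q s k $ r $ j) \<le> (\<Sum>r\<in>UNIV. A (s + k) $ i $ r * 1)"
      using Suc by (intro sum_mono mult_left_mono) auto
    then show ?case using Suc by (auto simp: Q_step intro!: sum_nonneg)
  qed
  have Q_row: "(\<Sum>j\<in>UNIV. Q s k $ i $ j) = 1" for s k i
  proof (induction k arbitrary: i)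
    case 0 then show ?case by (simp add: Q_0 mat_def)
  next
    case (Suc k)
    have "(\<Sum>j\<in>UNIV. Q s (Suc k) $ i $ j) = (\<Sum>r\<in>UNIV. \<Sum>j\<in>UNIV. A (s + k) $ i $ r * Q s k $ r $ j)"
      unfolding Q_step by (rule sum.swap)
    then show ?case using Suc by (simp flip: sum_distrib_left)
  qed
  have Q_osc: "(\<lambda>k. Q s k $ i $ j - Q s k $ i' $ j) \<longlonglongrightarrow> 0" for s i i' j
  proof -
    \<comment> \<open>\<open>consensus\<close> speaks of all times, so the product is padded with
      zeros before \<open>s\<close>; the noise 1 there pays for the jump at time
      \<open>s\<close>.\<close>
    define x where "x t i = (if t < s then 0 else Q s (t - s) $ i $ j)" for t i
    define e :: "nat \<Rightarrow> real" where "e t = (if t < s then 1 else 0)" for t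
    have "(\<lambda>t. x t i - x t i') \<longlonglongrightarrow> 0"
    proof (rule consensus)
      show "\<bar>x t i\<bar> \<le> 1" for t i using Q_bounds by (simp add: x_def)
      have "\<forall>\<^sub>F t in sequentially. e t = 0"
        by (auto simp: eventually_sequentially e_def intro!: exI[of _ s])
      then show "e \<longlonglongrightarrow> 0" by (rule tendsto_eventually)
      show "\<bar>x (Suc t) i - (\<Sum>j\<in>UNIV. A t $ i $ j * x t j)\<bar> \<le> e t" for t i
      proof (cases "t < s")
        case True
        then show ?thesis using Q_bounds by (simp add: x_def e_def)
      next
        case False
        then show ?thesis using Q_step[of s "t - s"] by (simp add: x_def e_def Suc_diff_le)
      qed
    qed
    then have "(\<lambda>k. x (k + s) i - x (k + s) i') \<longlonglongrightarrow> 0" by (rule LIMSEQ_ignore_initial_segment)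
    then show ?thesis by (simp add: x_def)
  qed
  \<comment> \<open>Each new row is an average of old rows, so column minima can only rise. They
    therefore converge, and \<open>Q_osc\<close> transfers the limit to every row.\<close>
  define lo where "lo s j k = Min (range (\<lambda>i. Q s k $ i $ j))" for s j k
  have lo_le: "lo s j k \<le> Q s k $ i $ j" for s j k i by (auto simp: lo_def)
  have lo_ge: "r \<le> lo s j k" if "\<And>i. r \<le> Q s k $ i $ j" for r s j k
    using that by (auto simp: lo_def)
  have lo_Suc: "lo s j k \<le> lo s j (Suc k)" for s j k
  proof (rule lo_ge)
    fix i
    have "lo s j k = (\<Sum>r\<in>UNIV. A (s + k) $ i $ r * lo s j k)" by (simp flip: sum_distrib_right)
    also have "\<dots> \<le> Q s (Suc k) $ i $ j"
      unfolding Q_step by (intro sum_mono mult_left_mono lo_le) simp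
    finally show "lo s j k \<le> Q s (Suc k) $ i $ j" .
  qed
  then have lo_mono: "incseq (lo s j)" for s j by (simp add: incseq_Suc_iff)
  have lo_1: "lo s j k \<le> 1" for s j k using lo_le Q_bounds order_trans by blast
  define \<pi> where "\<pi> s j = lim (lo s j)" for s j
  have lo_lim: "lo s j \<longlonglongrightarrow> \<pi> s j" for s j
  proof -
    have "convergent (lo s j)"
      using incseq_convergent[OF lo_mono, of s j 1] lo_1 unfolding convergent_def by metis
    then show ?thesis by (simp add: \<pi>_def convergent_LIMSEQ_iff)
  qed
  have Q_lim: "(\<lambda>k. Q s k $ i $ j) \<longlonglongrightarrow> \<pi> s j" for s i j
  proof -
    have "(\<lambda>k. Q s k $ i $ j - lo s j k) \<longlonglongrightarrow> 0"
    proof (rule Lim_null_comparison)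
      have "norm (Q s k $ i $ j - lo s j k) \<le> (\<Sum>i'\<in>UNIV. \<bar>Q s k $ i $ j - Q s k $ i' $ j\<bar>)" for k
      proof -
        have "lo s j k \<in> range (\<lambda>i. Q s k $ i $ j)" unfolding lo_def by (rule Min_in) auto
        then obtain i' where i': "lo s j k = Q s k $ i' $ j" by blast
        show ?thesis
          unfolding i' real_norm_def
          by (rule member_le_sum[of i' UNIV "\<lambda>i'. \<bar>Q s k $ i $ j - Q s k $ i' $ j\<bar>"]) auto
      qed
      then show "\<forall>\<^sub>F k in sequentially. norm (Q s k $ i $ j - lo s j k) \<le> (\<Sum>i'\<in>UNIV. \<bar>Q s k $ i $ j - Q s k $ i' $ j\<bar>)"
        by simp
      show "(\<lambda>k. \<Sum>i'\<in>UNIV. \<bar>Q s k $ i $ j - Q s k $ i' $ j\<bar>) \<longlonglongrightarrow> 0"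
        by (intro tendsto_null_sum tendsto_rabs_zero Q_osc)
    qed
    from tendsto_add[OF this lo_lim[of s j]] show ?thesis by simp
  qed
  show thesis
  proof
    show "0 < \<eta>" by (fact \<eta>(1))
    show "\<eta> \<le> \<pi> s j" for s j
    proof -
      \<comment> \<open>The diagonal entry 1 of the initial identity matrix spreads to the whole
        column within \<open>T\<close> steps.\<close>
      have "\<eta> \<le> lo s j T"
      proof (rule lo_ge)
        fix i
        have "\<eta> * Q s (s - s) $ j $ j \<le> Q s (s + T - s) $ i $ j"
          by (rule reach[of "\<lambda>t i. Q s (t - s) $ i $ j"]) (auto simp: Q_bounds Q_step Suc_diff_le)
        then show "\<eta> \<le> Q s T $ i $ j" by (simp add: Q_0 mat_def)
      qed
      also have "\<dots> \<le> \<pi> s j" using lo_lim lo_mono by (simp add: incseq_le)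
      finally show ?thesis .
    qed
    show "(\<Sum>i\<in>UNIV. \<pi> s i) = 1" for s
    proof (rule LIMSEQ_unique)
      show "(\<lambda>k. \<Sum>j\<in>UNIV. Q s k $ undefined $ j) \<longlonglongrightarrow> (\<Sum>i\<in>UNIV. \<pi> s i)"
        by (intro tendsto_sum Q_lim)
      show "(\<lambda>k. \<Sum>j\<in>UNIV. Q s k $ undefined $ j) \<longlonglongrightarrow> 1" by (simp add: Q_row)
    qed
    show "\<pi> s j = (\<Sum>i\<in>UNIV. \<pi> (Suc s) i * A s $ i $ j)" for s j
    proof (rule LIMSEQ_unique)
      show "(\<lambda>k. Q s (Suc k) $ undefined $ j) \<longlonglongrightarrow> \<pi> s j"
        using Q_lim by (rule LIMSEQ_Suc)
      show "(\<lambda>k. Q s (Suc k) $ undefined $ j) \<longlonglongrightarrow> (\<Sum>i\<in>UNIV. \<pi> (Suc s) i * A s $ i $ j)"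
        unfolding Q_shift matrix_matrix_mult_def by (simp, intro tendsto_sum tendsto_mult Q_lim tendsto_const)
    qed
  qed
qed

end

section \<open>Beliefs along a fixed signal path\<close>

definition prob_vector :: "('b::finite \<Rightarrow> real) \<Rightarrow> bool" where
  "prob_vector b \<longleftrightarrow> (\<forall>\<theta>. 0 \<le> b \<theta>) \<and> (\<Sum>\<theta>\<in>UNIV. b \<theta>) = 1"

lemma prob_vectorD:
  assumes "prob_vector b"
  shows "0 \<le> b \<theta>" "b \<theta> \<le> 1" "(\<Sum>\<theta>\<in>UNIV. b \<theta>) = 1"
  using assms member_le_sum[of \<theta> UNIV b] by (auto simp: prob_vector_def)

locale learning = connected_chain A
  for A :: "nat \<Rightarrow> real^'n::finite^'n" +
  fixes S :: "'n \<Rightarrow> 's set"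
    and l :: "'th::finite \<Rightarrow> ('n \<Rightarrow> 's) pmf"
    and \<theta>s :: 'th
    and \<mu>0 :: "'n \<Rightarrow> 'th pmf"
    and j0 :: 'n
  assumes finite_S: "\<And>i. finite (S i)"
    and support: "\<And>\<theta>. set_pmf (l \<theta>) \<subseteq> {s. \<forall>i. s i \<in> S i}"
    and positive: "\<And>i s \<theta>. s \<in> S i \<Longrightarrow> pmf (marginal l i \<theta>) s > 0"
    and prior: "pmf (\<mu>0 j0) \<theta>s > 0"
begin

abbreviation lik :: "'n \<Rightarrow> 'th \<Rightarrow> 's \<Rightarrow> real" where
  "lik i \<theta> u \<equiv> pmf (marginal l i \<theta>) u"

lemma set_marginal: "set_pmf (marginal l i \<theta>) \<subseteq> S i"
  using support by (auto simp: marginal_def)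

lemma lik_sum: "(\<Sum>u\<in>S i. lik i \<theta> u) = 1"
  using finite_S set_marginal by (rule sum_pmf_eq_1)

lemma S_nonempty: "S i \<noteq> {}"
  using lik_sum[of i] by auto

lemma lik_bound:
  obtains c where "0 < c" "c \<le> 1" "\<And>i \<theta> u. u \<in> S i \<Longrightarrow> c \<le> lik i \<theta> u"
proof -
  define X where "X = (\<lambda>(i, \<theta>, u). lik i \<theta> u) ` (SIGMA i:UNIV. UNIV \<times> S i)"
  have fin: "finite X" unfolding X_def by (intro finite_imageI finite_SigmaI finite_cartesian_product) (auto simp: finite_S)
  have X: "lik i \<theta> u \<in> X" if "u \<in> S i" for i \<theta> u
    using that unfolding X_def by force
  obtain u where "u \<in> S undefined" using S_nonempty by blast
  then have "X \<noteq> {}" using X by blast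
  show thesis
  proof
    show "0 < Min X" using fin \<open>X \<noteq> {}\<close> positive by (auto simp: X_def)
    show bound: "Min X \<le> lik i \<theta> u" if "u \<in> S i" for i \<theta> u using X[OF that] fin by simp
    show "Min X \<le> 1" using bound[OF \<open>u \<in> S undefined\<close>] pmf_le_1 by (rule order_trans)
  qed
qed

text \<open>This is the one-step forecast of signal \<open>u\<close> and also the denominator in
  Bayes' rule.\<close>

definition mix :: "'n \<Rightarrow> ('th \<Rightarrow> real) \<Rightarrow> 's \<Rightarrow> real" where
  "mix i b u = (\<Sum>\<theta>\<in>UNIV. lik i \<theta> u * b \<theta>)"

text \<open>The signal is a free argument so that signals which did not occur can be inserted as
  well.\<close>

definition update :: "nat \<Rightarrow> 'n \<Rightarrow> 's \<Rightarrow> ('n \<Rightarrow> 'th \<Rightarrow> real) \<Rightarrow> 'th \<Rightarrow> real" where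
  "update t i u \<beta> \<theta> = A t $ i $ i * (lik i \<theta> u * \<beta> i \<theta> / mix i (\<beta> i) u)
     + (\<Sum>j\<in>UNIV - {i}. A t $ i $ j * \<beta> j \<theta>)"

definition chi2 :: "'n \<Rightarrow> ('th \<Rightarrow> real) \<Rightarrow> real" where
  "chi2 i b = (\<Sum>u\<in>S i. (lik i \<theta>s u - mix i b u)\<^sup>2 / mix i b u)"

lemma belief_Suc: "belief l A \<mu>0 w (Suc t) i = update t i (w (Suc t) i) (belief l A \<mu>0 w t)"
  by (rule ext) (simp add: update_def mix_def)

lemma mix_le_1: "prob_vector b \<Longrightarrow> mix i b u \<le> 1"
proof -
  assume "prob_vector b"
  then have "mix i b u \<le> (\<Sum>\<theta>\<in>UNIV. 1 * b \<theta>)"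
    unfolding mix_def by (intro sum_mono mult_right_mono) (auto simp: prob_vectorD pmf_le_1)
  then show ?thesis using \<open>prob_vector b\<close> by (simp add: prob_vectorD)
qed

lemma mix_ge:
  assumes "prob_vector b" "\<And>\<theta>. c \<le> lik i \<theta> u"
  shows "c \<le> mix i b u"
proof -
  have "c = (\<Sum>\<theta>\<in>UNIV. c * b \<theta>)" using assms(1) by (simp add: prob_vectorD flip: sum_distrib_left)
  also have "\<dots> \<le> mix i b u"
    unfolding mix_def using assms by (intro sum_mono mult_right_mono) (auto simp: prob_vectorD)
  finally show ?thesis .
qed

lemma mix_pos: "prob_vector b \<Longrightarrow> u \<in> S i \<Longrightarrow> 0 < mix i b u"
proof -
  assume b: "prob_vector b" and u: "u \<in> S i"
  obtain c where "0 < c" "c \<le> 1" "\<And>i \<theta> u. u \<in> S i \<Longrightarrow> c \<le> lik i \<theta> u" by (fact lik_bound)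
  then show ?thesis using mix_ge[OF b, of c i u] u by force
qed

lemma mix_sum: "prob_vector b \<Longrightarrow> (\<Sum>u\<in>S i. mix i b u) = 1"
  unfolding mix_def by (subst sum.swap) (simp add: prob_vectorD lik_sum flip: sum_distrib_right)

lemma chi2_nonneg: "prob_vector b \<Longrightarrow> 0 \<le> chi2 i b"
  unfolding chi2_def by (intro sum_nonneg divide_nonneg_nonneg) (auto intro: less_imp_le mix_pos)

text \<open>The left side is the mean relative gain of the truth in a Bayes step. Adding
  \<open>mix i b u - lik i \<theta>s u\<close> to each term completes the square and changes nothing
  in total, as both laws sum to 1.\<close>

lemma chi2_eq:
  assumes "prob_vector b"
  shows "(\<Sum>u\<in>S i. lik i \<theta>s u * (lik i \<theta>s u / mix i b u - 1)) = chi2 i b"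
proof -
  have "chi2 i b = (\<Sum>u\<in>S i. lik i \<theta>s u * (lik i \<theta>s u / mix i b u - 1) - lik i \<theta>s u + mix i b u)"
    unfolding chi2_def
  proof (rule sum.cong)
    fix u assume "u \<in> S i"
    then have "mix i b u \<noteq> 0" using mix_pos[OF assms] by force
    then show "(lik i \<theta>s u - mix i b u)\<^sup>2 / mix i b u =
        lik i \<theta>s u * (lik i \<theta>s u / mix i b u - 1) - lik i \<theta>s u + mix i b u"
      by (simp add: field_simps power2_eq_square)
  qed simp
  then show ?thesis using assms by (simp add: sum.distrib sum_subtractf lik_sum mix_sum)
qed

text \<open>Averaging plus an innovation, which vanishes when the forecast of \<open>u\<close>
  equals its likelihood. All drift computations start from this split.\<close>

lemma update_eq:
  "update t i u \<beta> \<theta> = (\<Sum>j\<in>UNIV. A t $ i $ j * \<beta> j \<theta>)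
     + A t $ i $ i * \<beta> i \<theta> * (lik i \<theta> u / mix i (\<beta> i) u - 1)"
  by (simp add: update_def sum.remove[of UNIV i] algebra_simps)

text \<open>Because \<open>mix\<close> is at most 1, a Bayes step keeps at least the fraction
  \<open>c\<close>. This supplies the hypothesis of \<open>propagation\<close>.\<close>

lemma update_ge:
  assumes "\<And>j. prob_vector (\<beta> j)" "u \<in> S i" "0 < c" "c \<le> 1" "c \<le> lik i \<theta> u"
  shows "c * (\<Sum>j\<in>UNIV. A t $ i $ j * \<beta> j \<theta>) \<le> update t i u \<beta> \<theta>"
proof -
  have m: "0 < mix i (\<beta> i) u" "mix i (\<beta> i) u \<le> 1" using assms mix_pos mix_le_1 by auto
  have b: "0 \<le> \<beta> j \<theta>" for j using assms(1) prob_vectorD by blast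
  have "c * (A t $ i $ i * \<beta> i \<theta>) = A t $ i $ i * (c * \<beta> i \<theta>)" by simp
  also have "\<dots> \<le> A t $ i $ i * (lik i \<theta> u * \<beta> i \<theta> / mix i (\<beta> i) u)"
  proof (rule mult_left_mono)
    have "c * \<beta> i \<theta> * mix i (\<beta> i) u \<le> lik i \<theta> u * \<beta> i \<theta> * 1"
      using assms m b by (intro mult_mono) auto
    then show "c * \<beta> i \<theta> \<le> lik i \<theta> u * \<beta> i \<theta> / mix i (\<beta> i) u" using m by (simp add: field_simps)
  qed simp
  finally have 1: "c * (A t $ i $ i * \<beta> i \<theta>) \<le> A t $ i $ i * (lik i \<theta> u * \<beta> i \<theta> / mix i (\<beta> i) u)" .
  have "0 \<le> (\<Sum>j\<in>UNIV - {i}. A t $ i $ j * \<beta> j \<theta>)" using b by (intro sum_nonneg) auto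
  then have "c * (\<Sum>j\<in>UNIV - {i}. A t $ i $ j * \<beta> j \<theta>) \<le> (\<Sum>j\<in>UNIV - {i}. A t $ i $ j * \<beta> j \<theta>)"
    using assms by (simp add: mult_left_le_one_le)
  with 1 show ?thesis by (simp add: update_def sum.remove[of UNIV i] distrib_left)
qed

lemma prob_vector_update:
  assumes "\<And>j. prob_vector (\<beta> j)" "u \<in> S i"
  shows "prob_vector (update t i u \<beta>)"
  unfolding prob_vector_def
proof (intro conjI allI)
  have m: "0 < mix i (\<beta> i) u" using assms mix_pos by auto
  show "0 \<le> update t i u \<beta> \<theta>" for \<theta>
    unfolding update_def using m assms prob_vectorD
    by (intro add_nonneg_nonneg mult_nonneg_nonneg divide_nonneg_pos sum_nonneg) auto
  have "(\<Sum>\<theta>\<in>UNIV. \<Sum>j\<in>UNIV. A t $ i $ j * \<beta> j \<theta>) = 1"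
    by (subst sum.swap) (simp add: prob_vectorD(3)[OF assms(1)] flip: sum_distrib_left)
  moreover have "(\<Sum>\<theta>\<in>UNIV. \<beta> i \<theta> * (lik i \<theta> u / mix i (\<beta> i) u - 1)) = 0"
  proof -
    have "(\<Sum>\<theta>\<in>UNIV. \<beta> i \<theta> * (lik i \<theta> u / mix i (\<beta> i) u - 1)) =
        (\<Sum>\<theta>\<in>UNIV. lik i \<theta> u * \<beta> i \<theta>) / mix i (\<beta> i) u - (\<Sum>\<theta>\<in>UNIV. \<beta> i \<theta>)"
      by (simp add: sum_divide_distrib right_diff_distrib sum_subtractf mult.commute)
    then show ?thesis using m prob_vectorD(3)[OF assms(1), of i] by (simp flip: mix_def)
  qed
  ultimately show "(\<Sum>\<theta>\<in>UNIV. update t i u \<beta> \<theta>) = 1"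
    by (simp add: update_eq sum.distrib mult.assoc flip: sum_distrib_left)
qed

text \<open>The quotient is the forecast of \<open>v\<close> after a Bayes step on \<open>u\<close>;
  it is the only part that depends on \<open>u\<close>.\<close>

lemma mix_update:
  "mix i (update t i u \<beta>) v = A t $ i $ i * ((\<Sum>\<theta>\<in>UNIV. lik i \<theta> v * lik i \<theta> u * \<beta> i \<theta>) / mix i (\<beta> i) u)
     + (\<Sum>\<theta>\<in>UNIV. lik i \<theta> v * (\<Sum>j\<in>UNIV - {i}. A t $ i $ j * \<beta> j \<theta>))"
  by (simp add: mix_def[of i "update t i u \<beta>"] update_def distrib_left sum.distrib sum_distrib_left
      sum_divide_distrib mult_ac)

text \<open>As forecasts are at most 1, a squared forecast error is at most its term of
  \<open>chi2\<close>, and the lower bound \<open>\<epsilon>\<close> removes the belief factor. The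
  sequence \<open>b\<close> is arbitrary so that it can also be a sequence of hypothetical
  updates.\<close>

lemma mix_tendsto:
  assumes b: "\<And>t. prob_vector (b t)" and u: "u \<in> S i" and "0 < \<epsilon>"
    and low: "\<forall>\<^sub>F t in sequentially. \<epsilon> \<le> b t \<theta>s"
    and chi: "(\<lambda>t. b t \<theta>s * chi2 i (b t)) \<longlonglongrightarrow> 0"
  shows "(\<lambda>t. mix i (b t) u) \<longlonglongrightarrow> lik i \<theta>s u"
proof -
  have "(\<lambda>t. mix i (b t) u - lik i \<theta>s u) \<longlonglongrightarrow> 0"
  proof (rule Lim_null_comparison)
    have "(\<lambda>t. sqrt (b t \<theta>s * chi2 i (b t) / \<epsilon>)) \<longlonglongrightarrow> sqrt (0 / \<epsilon>)"
      using chi \<open>0 < \<epsilon>\<close> by (intro tendsto_real_sqrt tendsto_divide tendsto_const) auto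
    then show "(\<lambda>t. sqrt (b t \<theta>s * chi2 i (b t) / \<epsilon>)) \<longlonglongrightarrow> 0" by simp
    show "\<forall>\<^sub>F t in sequentially. norm (mix i (b t) u - lik i \<theta>s u) \<le> sqrt (b t \<theta>s * chi2 i (b t) / \<epsilon>)"
      using low
    proof eventually_elim
      case (elim t)
      have m: "0 < mix i (b t) u" "mix i (b t) u \<le> 1" using b u mix_pos mix_le_1 by auto
      have "(lik i \<theta>s u - mix i (b t) u)\<^sup>2 * mix i (b t) u \<le> (lik i \<theta>s u - mix i (b t) u)\<^sup>2 * 1"
        using m by (intro mult_left_mono) auto
      then have "(lik i \<theta>s u - mix i (b t) u)\<^sup>2 \<le> (lik i \<theta>s u - mix i (b t) u)\<^sup>2 / mix i (b t) u"
        using m by (simp add: field_simps)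
      also have "\<dots> \<le> chi2 i (b t)"
        unfolding chi2_def using u finite_S b
        by (intro member_le_sum) (auto intro!: divide_nonneg_nonneg less_imp_le[OF mix_pos])
      also have "\<dots> \<le> b t \<theta>s * chi2 i (b t) / \<epsilon>"
        using elim \<open>0 < \<epsilon>\<close> chi2_nonneg[OF b, of i t] by (simp add: field_simps mult_right_mono)
      finally have "(mix i (b t) u - lik i \<theta>s u)\<^sup>2 \<le> b t \<theta>s * chi2 i (b t) / \<epsilon>"
        by (simp add: power2_commute)
      then show ?case using real_le_rsqrt by (simp add: real_sqrt_le_mono flip: real_sqrt_abs)
    qed
  qed
  then show ?thesis by (simp add: LIM_zero_iff)
qed

section \<open>Positivity, extinction and consensus of beliefs on an admissible path\<close>

definition admissible :: "(nat \<Rightarrow> 'n \<Rightarrow> 's) \<Rightarrow> bool" where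
  "admissible w \<longleftrightarrow> (\<forall>t i. 1 \<le> t \<longrightarrow> w t i \<in> S i)"

abbreviation bel :: "(nat \<Rightarrow> 'n \<Rightarrow> 's) \<Rightarrow> nat \<Rightarrow> 'n \<Rightarrow> 'th \<Rightarrow> real" where
  "bel \<equiv> belief l A \<mu>0"

lemma admissibleD: "admissible w \<Longrightarrow> w (Suc t) i \<in> S i"
  by (simp add: admissible_def)

lemma prob_vector_bel:
  assumes "admissible w"
  shows "prob_vector (bel w t i)"
proof (induction t arbitrary: i)
  case 0
  show ?case by (simp add: prob_vector_def sum_pmf_eq_1)
next
  case (Suc t)
  then show ?case
    unfolding belief_Suc using admissibleD[OF assms] by (rule prob_vector_update)
qed

lemmas belD = prob_vectorD[OF prob_vector_bel]

lemma bel_step: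
  "bel w (Suc t) i \<theta> = (\<Sum>j\<in>UNIV. A t $ i $ j * bel w t j \<theta>)
     + A t $ i $ i * bel w t i \<theta> * (lik i \<theta> (w (Suc t) i) / mix i (bel w t i) (w (Suc t) i) - 1)"
  unfolding belief_Suc update_eq ..

lemma bel_reach:
  obtains \<eta> T where "0 < \<eta>" "\<eta> \<le> 1"
    "\<And>w s i j \<theta>. admissible w \<Longrightarrow> \<eta> * bel w s j \<theta> \<le> bel w (s + T) i \<theta>"
proof -
  obtain c where c: "0 < c" "c \<le> 1" "\<And>i \<theta> u. u \<in> S i \<Longrightarrow> c \<le> lik i \<theta> u" by (fact lik_bound)
  obtain \<eta> T where \<eta>: "0 < \<eta>" "\<eta> \<le> 1" and reach:
    "\<And>y s i j. (\<And>i. 0 \<le> y s i) \<Longrightarrow>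
       (\<And>t i. s \<le> t \<Longrightarrow> c * (\<Sum>j\<in>UNIV. A t $ i $ j * y t j) \<le> y (Suc t) i) \<Longrightarrow>
       \<eta> * y s j \<le> y (s + T) i"
    by (fact propagation[OF c(1,2)])
  show thesis
  proof
    fix w s i j \<theta> assume w: "admissible w"
    show "\<eta> * bel w s j \<theta> \<le> bel w (s + T) i \<theta>"
    proof (rule reach[of "\<lambda>t i. bel w t i \<theta>"])
      show "c * (\<Sum>j\<in>UNIV. A t $ i $ j * bel w t j \<theta>) \<le> bel w (Suc t) i \<theta>" for t i
        unfolding belief_Suc
        by (rule update_ge) (use w c prob_vector_bel admissibleD in auto)
    qed (simp add: belD w)
  qed (fact \<eta>)+
qed

text \<open>Agent \<open>j0\<close> keeps at least the fraction \<open>c * \<delta>\<close> of its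
  belief in the truth per step through its self-loop, and \<open>T\<close> steps later everybody has
  a share. The bound may decay in \<open>k\<close>, but it is uniform over paths, so the reciprocals
  are bounded at each fixed time.\<close>

lemma truth_pos:
  obtains \<eta> \<kappa> T where "0 < \<eta>" "0 < \<kappa>"
    "\<And>w k i. admissible w \<Longrightarrow> \<eta> * \<kappa> ^ k \<le> bel w (T + k) i \<theta>s"
proof -
  obtain c where c: "0 < c" "c \<le> 1" "\<And>i \<theta> u. u \<in> S i \<Longrightarrow> c \<le> lik i \<theta> u" by (fact lik_bound)
  obtain \<delta> where \<delta>: "0 < \<delta>" "\<delta> \<le> 1" "\<And>t i j. 0 < A t $ i $ j \<Longrightarrow> \<delta> \<le> A t $ i $ j"
    "\<And>t i. \<delta> \<le> A t $ i $ i" by (fact entry_bound)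
  obtain \<eta> T where \<eta>: "0 < \<eta>" "\<eta> \<le> 1" and reach:
    "\<And>w s i j \<theta>. admissible w \<Longrightarrow> \<eta> * bel w s j \<theta> \<le> bel w (s + T) i \<theta>" by (fact bel_reach)
  have keep: "(c * \<delta>) ^ k * pmf (\<mu>0 j0) \<theta>s \<le> bel w k j0 \<theta>s" if w: "admissible w" for w k
  proof (induction k)
    case (Suc k)
    have "(c * \<delta>) ^ Suc k * pmf (\<mu>0 j0) \<theta>s = c * (\<delta> * ((c * \<delta>) ^ k * pmf (\<mu>0 j0) \<theta>s))" by simp
    also have "\<dots> \<le> c * (A k $ j0 $ j0 * bel w k j0 \<theta>s)"
      using Suc c \<delta> by (intro mult_left_mono mult_mono) auto
    also have "\<dots> \<le> c * (\<Sum>j\<in>UNIV. A k $ j0 $ j * bel w k j \<theta>s)"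
      using c belD[OF w]
      by (intro mult_left_mono member_le_sum[of j0 UNIV "\<lambda>j. A k $ j0 $ j * bel w k j \<theta>s"]) auto
    also have "\<dots> \<le> bel w (Suc k) j0 \<theta>s"
      unfolding belief_Suc by (rule update_ge) (use w c prob_vector_bel admissibleD in auto)
    finally show ?case .
  qed simp
  show thesis
  proof
    show "0 < \<eta> * pmf (\<mu>0 j0) \<theta>s" "0 < c * \<delta>" using \<eta> prior c \<delta> by auto
    fix w k i assume w: "admissible w"
    have "\<eta> * pmf (\<mu>0 j0) \<theta>s * (c * \<delta>) ^ k \<le> \<eta> * bel w k j0 \<theta>s"
      using keep[OF w, of k] \<eta> by (simp add: mult_ac)
    also have "\<dots> \<le> bel w (T + k) i \<theta>s" using reach[OF w, of k j0 \<theta>s i] by (simp add: add.commute)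
    finally show "\<eta> * pmf (\<mu>0 j0) \<theta>s * (c * \<delta>) ^ k \<le> bel w (T + k) i \<theta>s" .
  qed
qed

text \<open>Forecasts that stay correct after every possible next signal are correct two steps ahead, and
  the two-step forecast of \<open>(v, v)\<close> controls the variance of the likelihood of \<open>v\<close> under the belief.\<close>

lemma bel_vanishes:
  assumes w: "admissible w" and "0 < \<epsilon>"
    and low: "\<forall>\<^sub>F t in sequentially. \<forall>j. \<epsilon> \<le> bel w t j \<theta>s"
    and chi: "(\<lambda>t. bel w t i \<theta>s * chi2 i (bel w t i)) \<longlonglongrightarrow> 0"
    and chi': "\<And>u. u \<in> S i \<Longrightarrow>
      (\<lambda>t. update t i u (bel w t) \<theta>s * chi2 i (update t i u (bel w t))) \<longlonglongrightarrow> 0"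
    and \<theta>: "\<theta> \<notin> equivalent_states l \<theta>s i"
  shows "(\<lambda>t. bel w t i \<theta>) \<longlonglongrightarrow> 0"
proof -
  obtain c where c: "0 < c" "c \<le> 1" "\<And>i \<theta> u. u \<in> S i \<Longrightarrow> c \<le> lik i \<theta> u" by (fact lik_bound)
  obtain \<delta> where \<delta>: "0 < \<delta>" "\<delta> \<le> 1" "\<And>t i j. 0 < A t $ i $ j \<Longrightarrow> \<delta> \<le> A t $ i $ j"
    "\<And>t i. \<delta> \<le> A t $ i $ i" by (fact entry_bound)
  note pv = prob_vector_bel[OF w]
  have m1: "(\<lambda>t. mix i (bel w t i) u) \<longlonglongrightarrow> lik i \<theta>s u" if "u \<in> S i" for u
    by (rule mix_tendsto[OF pv that \<open>0 < \<epsilon>\<close> _ chi]) (use low in \<open>auto elim: eventually_mono\<close>)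
  have m1': "(\<lambda>t. mix i (update t i u (bel w t)) v) \<longlonglongrightarrow> lik i \<theta>s v"
    if u: "u \<in> S i" and v: "v \<in> S i" for u v
  proof (rule mix_tendsto[OF _ v _ _ chi'[OF u]])
    show "prob_vector (update t i u (bel w t))" for t using pv u by (rule prob_vector_update)
    show "0 < c * \<epsilon>" using c \<open>0 < \<epsilon>\<close> by simp
    show "\<forall>\<^sub>F t in sequentially. c * \<epsilon> \<le> update t i u (bel w t) \<theta>s"
      using low
    proof eventually_elim
      case (elim t)
      have "\<epsilon> = (\<Sum>j\<in>UNIV. A t $ i $ j * \<epsilon>)" by (simp flip: sum_distrib_right)
      also have "\<dots> \<le> (\<Sum>j\<in>UNIV. A t $ i $ j * bel w t j \<theta>s)"
        using elim by (intro sum_mono mult_left_mono) auto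
      finally have "c * \<epsilon> \<le> c * (\<Sum>j\<in>UNIV. A t $ i $ j * bel w t j \<theta>s)" using c by simp
      also have "\<dots> \<le> update t i u (bel w t) \<theta>s"
        by (rule update_ge) (use c u pv in auto)
      finally show ?case .
    qed
  qed
  define m2 where "m2 t u v = (\<Sum>\<theta>\<in>UNIV. lik i \<theta> v * lik i \<theta> u * bel w t i \<theta>)" for t u v
  have m2_lim: "(\<lambda>t. m2 t u v) \<longlonglongrightarrow> lik i \<theta>s v * lik i \<theta>s u" if u: "u \<in> S i" and v: "v \<in> S i" for u v
  proof -
    \<comment> \<open>\<open>?d\<close> is the change that a Bayes step on \<open>u\<close> makes in
      the forecast of \<open>v\<close>. In \<open>?avg\<close> the Bayes parts of the hypothetical
      updates average to the current forecast while the neighbours' part is unchanged, so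
      subtracting \<open>?avg\<close> cancels the neighbours and leaves
      \<open>A t $ i $ i * ?d t\<close>.\<close>
    let ?d = "\<lambda>t. m2 t u v / mix i (bel w t i) u - mix i (bel w t i) v"
    let ?avg = "\<lambda>t. \<Sum>u'\<in>S i. mix i (bel w t i) u' * mix i (update t i u' (bel w t)) v"
    have avg: "mix i (update t i u (bel w t)) v - ?avg t = A t $ i $ i * ?d t" for t
    proof -
      define R where "R = (\<Sum>\<theta>\<in>UNIV. lik i \<theta> v * (\<Sum>j\<in>UNIV - {i}. A t $ i $ j * bel w t j \<theta>))"
      have nz: "mix i (bel w t i) u' \<noteq> 0" if "u' \<in> S i" for u' using mix_pos[OF pv[of t i] that] by simp
      have "?avg t = (\<Sum>u'\<in>S i. A t $ i $ i * m2 t u' v + mix i (bel w t i) u' * R)"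
        by (intro sum.cong) (auto simp: mix_update R_def m2_def nz distrib_left)
      also have "\<dots> = A t $ i $ i * (\<Sum>u'\<in>S i. m2 t u' v) + R"
        by (simp add: sum.distrib mix_sum[OF pv] flip: sum_distrib_left sum_distrib_right)
      also have "(\<Sum>u'\<in>S i. m2 t u' v) = mix i (bel w t i) v"
        unfolding m2_def mix_def
        by (subst sum.swap) (simp add: lik_sum flip: sum_distrib_left sum_distrib_right)
      finally show ?thesis by (simp add: mix_update m2_def R_def right_diff_distrib)
    qed
    have "?avg \<longlonglongrightarrow> (\<Sum>u'\<in>S i. lik i \<theta>s u' * lik i \<theta>s v)"
      by (intro tendsto_sum tendsto_mult m1 m1' v)
    then have "?avg \<longlonglongrightarrow> lik i \<theta>s v" by (simp add: lik_sum flip: sum_distrib_right)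
    from tendsto_diff[OF m1'[OF u v] this]
    have Ad: "(\<lambda>t. A t $ i $ i * ?d t) \<longlonglongrightarrow> 0" by (simp add: avg)
    \<comment> \<open>Self-weights are at least \<open>\<delta>\<close>, so the factor can be
      divided out.\<close>
    have "?d \<longlonglongrightarrow> 0"
    proof (rule Lim_null_comparison)
      show "(\<lambda>t. \<bar>A t $ i $ i * ?d t\<bar> / \<delta>) \<longlonglongrightarrow> 0"
        using tendsto_divide[OF tendsto_rabs_zero[OF Ad] tendsto_const, of \<delta>] \<delta>(1) by simp
      have "norm (?d t) \<le> \<bar>A t $ i $ i * ?d t\<bar> / \<delta>" for t
        using \<delta>(1) mult_right_mono[OF \<delta>(4)[of t i] abs_ge_zero[of "?d t"]]
        by (simp add: abs_mult pos_le_divide_eq mult.commute)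
      then show "\<forall>\<^sub>F t in sequentially. norm (?d t) \<le> \<bar>A t $ i $ i * ?d t\<bar> / \<delta>" by simp
    qed
    from tendsto_mult[OF tendsto_add[OF this m1[OF v]] m1[OF u]]
    have "(\<lambda>t. m2 t u v / mix i (bel w t i) u * mix i (bel w t i) u) \<longlonglongrightarrow> lik i \<theta>s v * lik i \<theta>s u"
      by simp
    moreover have "m2 t u v / mix i (bel w t i) u * mix i (bel w t i) u = m2 t u v" for t
      using mix_pos[OF pv[of t i] u] by simp
    ultimately show ?thesis by simp
  qed
  have "\<exists>v\<in>S i. lik i \<theta> v \<noteq> lik i \<theta>s v"
  proof (rule ccontr)
    assume "\<not> ?thesis"
    moreover have "lik i \<theta>' v = 0" if "v \<notin> S i" for \<theta>' v
      using that set_marginal by (auto simp: pmf_eq_0_set_pmf)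
    ultimately have "marginal l i \<theta> = marginal l i \<theta>s" by (intro pmf_eqI) metis
    then show False using \<theta> by (simp add: equivalent_states_def)
  qed
  then obtain v where v: "v \<in> S i" "lik i \<theta> v \<noteq> lik i \<theta>s v" by blast
  let ?q = "\<lambda>t \<theta>. (lik i \<theta> v - lik i \<theta>s v)\<^sup>2 * bel w t i \<theta>"
  have "(\<Sum>\<theta>\<in>UNIV. ?q t \<theta>) =
      m2 t v v - 2 * lik i \<theta>s v * mix i (bel w t i) v + (lik i \<theta>s v)\<^sup>2 * (\<Sum>\<theta>\<in>UNIV. bel w t i \<theta>)" for t
    unfolding m2_def mix_def sum_distrib_left
    by (simp add: power2_eq_square algebra_simps sum.distrib sum_subtractf)
  then have q_sum: "(\<Sum>\<theta>\<in>UNIV. ?q t \<theta>) =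
      m2 t v v - 2 * lik i \<theta>s v * mix i (bel w t i) v + (lik i \<theta>s v)\<^sup>2" for t
    by (simp add: belD[OF w])
  have "(\<lambda>t. m2 t v v - 2 * lik i \<theta>s v * mix i (bel w t i) v + (lik i \<theta>s v)\<^sup>2) \<longlonglongrightarrow>
      lik i \<theta>s v * lik i \<theta>s v - 2 * lik i \<theta>s v * lik i \<theta>s v + (lik i \<theta>s v)\<^sup>2"
    by (intro tendsto_intros m2_lim m1 v)
  then have q_lim: "(\<lambda>t. \<Sum>\<theta>\<in>UNIV. ?q t \<theta>) \<longlonglongrightarrow> 0"
    unfolding q_sum by (simp add: power2_eq_square)
  have "(\<lambda>t. ?q t \<theta>) \<longlonglongrightarrow> 0"
  proof (rule Lim_null_comparison[OF _ q_lim])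
    have "norm (?q t \<theta>) \<le> (\<Sum>\<theta>\<in>UNIV. ?q t \<theta>)" for t
      using belD(1)[OF w] member_le_sum[of \<theta> UNIV "?q t"] by (simp add: abs_mult)
    then show "\<forall>\<^sub>F t in sequentially. norm (?q t \<theta>) \<le> (\<Sum>\<theta>\<in>UNIV. ?q t \<theta>)" by simp
  qed
  then have "(\<lambda>t. ?q t \<theta> / (lik i \<theta> v - lik i \<theta>s v)\<^sup>2) \<longlonglongrightarrow> 0 / (lik i \<theta> v - lik i \<theta>s v)\<^sup>2"
    using v by (intro tendsto_divide tendsto_const) auto
  then show ?thesis using v by simp
qed

text \<open>Agent \<open>i\<close> inherits at time \<open>t + T\<close> the share
  \<open>\<eta>\<close> of what \<open>j\<close> believes at time \<open>t\<close>, so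
  \<open>j\<close> cannot keep belief that \<open>i\<close> loses.\<close>

lemma bel_vanishes_everywhere:
  assumes w: "admissible w" and lim: "(\<lambda>t. bel w t i \<theta>) \<longlonglongrightarrow> 0"
  shows "(\<lambda>t. bel w t j \<theta>) \<longlonglongrightarrow> 0"
proof -
  obtain \<eta> T where \<eta>: "0 < \<eta>" "\<eta> \<le> 1" and reach:
    "\<And>w s i j \<theta>. admissible w \<Longrightarrow> \<eta> * bel w s j \<theta> \<le> bel w (s + T) i \<theta>" by (fact bel_reach)
  show ?thesis
  proof (rule Lim_null_comparison)
    show "(\<lambda>t. bel w (t + T) i \<theta> / \<eta>) \<longlonglongrightarrow> 0"
      using tendsto_divide[OF LIMSEQ_ignore_initial_segment[OF lim, of T] tendsto_const, of \<eta>] \<eta> by simp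
    have "norm (bel w t j \<theta>) \<le> bel w (t + T) i \<theta> / \<eta>" for t
      using reach[OF w, of t j \<theta> i] \<eta> belD(1)[OF w] by (simp add: pos_le_divide_eq mult.commute)
    then show "\<forall>\<^sub>F t in sequentially. norm (bel w t j \<theta>) \<le> bel w (t + T) i \<theta> / \<eta>" by simp
  qed
qed

lemma bel_consensus:
  assumes w: "admissible w" and "0 < \<epsilon>"
    and low: "\<forall>\<^sub>F t in sequentially. \<forall>j. \<epsilon> \<le> bel w t j \<theta>s"
    and chi: "\<And>i. (\<lambda>t. bel w t i \<theta>s * chi2 i (bel w t i)) \<longlonglongrightarrow> 0"
    and \<theta>: "\<theta> \<in> (\<Inter>i. equivalent_states l \<theta>s i)"
  shows "(\<lambda>t. bel w t i \<theta> - bel w t j \<theta>) \<longlonglongrightarrow> 0"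
proof (rule consensus)
  note pv = prob_vector_bel[OF w]
  have lik_eq: "lik i \<theta> u = lik i \<theta>s u" for i u using \<theta> by (simp add: equivalent_states_def)
  have m1: "(\<lambda>t. mix i (bel w t i) u) \<longlonglongrightarrow> lik i \<theta>s u" if "u \<in> S i" for i u
    by (rule mix_tendsto[OF pv that \<open>0 < \<epsilon>\<close> _ chi]) (use low in \<open>auto elim: eventually_mono\<close>)
  \<comment> \<open>Summing over all agents and all possible signals gives one noise bound that is
    common to the agents and independent of the signal that occurs.\<close>
  let ?e = "\<lambda>t. \<Sum>i\<in>UNIV. \<Sum>u\<in>S i. \<bar>lik i \<theta>s u / mix i (bel w t i) u - 1\<bar>"
  show "\<bar>bel w t i \<theta>\<bar> \<le> 1" for t i using belD[OF w] by simp
  have "?e \<longlonglongrightarrow> (\<Sum>i\<in>UNIV. \<Sum>u\<in>S i. \<bar>lik i \<theta>s u / lik i \<theta>s u - 1\<bar>)"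
    using positive by (intro tendsto_intros m1) (auto simp: order_less_imp_not_eq2)
  moreover have "(\<Sum>i\<in>UNIV. \<Sum>u\<in>S i. \<bar>lik i \<theta>s u / lik i \<theta>s u - 1\<bar>) = 0"
    using positive by (intro sum.neutral ballI) (auto simp: order_less_imp_not_eq2)
  ultimately show "?e \<longlonglongrightarrow> 0" by simp
  fix t i
  let ?u = "w (Suc t) i"
  have u: "?u \<in> S i" using w by (rule admissibleD)
  have "\<bar>bel w (Suc t) i \<theta> - (\<Sum>j\<in>UNIV. A t $ i $ j * bel w t j \<theta>)\<bar> =
      A t $ i $ i * bel w t i \<theta> * \<bar>lik i \<theta>s ?u / mix i (bel w t i) ?u - 1\<bar>"
    by (simp add: bel_step lik_eq abs_mult belD[OF w] del: belief.simps)
  also have "\<dots> \<le> 1 * \<bar>lik i \<theta>s ?u / mix i (bel w t i) ?u - 1\<bar>"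
    using belD[OF w] by (intro mult_right_mono) (auto intro: mult_le_one)
  also have "\<dots> \<le> (\<Sum>u\<in>S i. \<bar>lik i \<theta>s u / mix i (bel w t i) u - 1\<bar>)"
    using member_le_sum[OF u, of "\<lambda>u. \<bar>lik i \<theta>s u / mix i (bel w t i) u - 1\<bar>"] finite_S by simp
  also have "\<dots> \<le> ?e t"
    by (rule member_le_sum[of i UNIV "\<lambda>i. \<Sum>u\<in>S i. \<bar>lik i \<theta>s u / mix i (bel w t i) u - 1\<bar>"])
      (auto intro: sum_nonneg)
  finally show "\<bar>bel w (Suc t) i \<theta> - (\<Sum>j\<in>UNIV. A t $ i $ j * bel w t j \<theta>)\<bar> \<le> ?e t" .
qed

text \<open>The forecast error is a belief-weighted sum of differences of path likelihoods: for each
  state either the difference is zero or the belief vanishes.\<close>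

lemma weakly_merges_if_vanishes:
  assumes w: "admissible w"
    and van: "\<And>\<theta>. \<theta> \<notin> equivalent_states l \<theta>s i \<Longrightarrow> (\<lambda>t. bel w t i \<theta>) \<longlonglongrightarrow> 0"
  shows "weakly_merges S l \<theta>s (bel w) i"
  unfolding weakly_merges_def
proof (intro allI impI)
  fix k :: nat and s
  let ?P = "\<lambda>\<theta>. \<Prod>r=1..k. lik i \<theta> (s r)"
  have "(\<lambda>t. \<Sum>\<theta>\<in>UNIV. (?P \<theta> - ?P \<theta>s) * bel w t i \<theta>) \<longlonglongrightarrow> 0"
  proof (rule tendsto_null_sum)
    fix \<theta>
    show "(\<lambda>t. (?P \<theta> - ?P \<theta>s) * bel w t i \<theta>) \<longlonglongrightarrow> 0"
    proof (cases "\<theta> \<in> equivalent_states l \<theta>s i")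
      case True
      then show ?thesis by (simp add: equivalent_states_def)
    next
      case False
      then show ?thesis by (intro tendsto_mult_right_zero van)
    qed
  qed
  moreover have "(\<Sum>\<theta>\<in>UNIV. (?P \<theta> - ?P \<theta>s) * bel w t i \<theta>) = forecast l i (bel w t i) k s - ?P \<theta>s" for t
    by (simp add: forecast_def left_diff_distrib sum_subtractf belD[OF w] flip: sum_distrib_left)
  ultimately show "(\<lambda>t. forecast l i (bel w t i) k s) \<longlonglongrightarrow> ?P \<theta>s"
    by (simp add: LIM_zero_iff)
qed

lemma learns_if_vanishes:
  assumes w: "admissible w" and ident: "identifiable l \<theta>s"
    and van: "\<And>i \<theta>. \<theta> \<notin> equivalent_states l \<theta>s i \<Longrightarrow> (\<lambda>t. bel w t i \<theta>) \<longlonglongrightarrow> 0"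
  shows "asymptotically_learns \<theta>s (bel w) i"
proof -
  have "(\<lambda>t. bel w t i \<theta>) \<longlonglongrightarrow> 0" if "\<theta> \<noteq> \<theta>s" for \<theta>
  proof -
    have "\<theta> \<notin> (\<Inter>j. equivalent_states l \<theta>s j)"
      using ident that by (simp add: identifiable_def)
    then obtain j where "\<theta> \<notin> equivalent_states l \<theta>s j" by auto
    then show ?thesis using van bel_vanishes_everywhere[OF w] by blast
  qed
  then have "(\<lambda>t. 1 - (\<Sum>\<theta>\<in>UNIV - {\<theta>s}. bel w t i \<theta>)) \<longlonglongrightarrow> 1 - 0"
    by (intro tendsto_diff tendsto_const tendsto_null_sum) auto
  moreover have "1 - (\<Sum>\<theta>\<in>UNIV - {\<theta>s}. bel w t i \<theta>) = bel w t i \<theta>s" for t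
    using belD(3)[OF w, of t i] by (simp add: sum.remove[of UNIV \<theta>s])
  ultimately show ?thesis by (simp add: asymptotically_learns_def)
qed

end

section \<open>Random signals\<close>

text \<open>The expected total sum is finite, so almost every series converges and its terms tend to
  0.\<close>

lemma (in prob_space) AE_tendsto_0_if_summable:
  fixes X :: "nat \<Rightarrow> 'a \<Rightarrow> real"
  assumes int: "\<And>t. integrable M (X t)" and nonneg: "\<And>t x. x \<in> space M \<Longrightarrow> 0 \<le> X t x"
    and sum: "\<And>n. (\<Sum>t<n. \<integral>x. X t x \<partial>M) \<le> K"
  shows "AE x in M. (\<lambda>t. X t x) \<longlonglongrightarrow> 0"
proof -
  have [measurable]: "X t \<in> borel_measurable M" for t using int by auto
  have "(\<integral>\<^sup>+x. (\<Sum>t. ennreal (X t x)) \<partial>M) = (\<Sum>t. \<integral>\<^sup>+x. ennreal (X t x) \<partial>M)"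
    by (rule nn_integral_suminf) simp
  also have "\<dots> = (\<Sum>t. ennreal (\<integral>x. X t x \<partial>M))"
    by (intro suminf_cong nn_integral_eq_integral int AE_I2 nonneg)
  also have "\<dots> \<le> ennreal K"
  proof (rule suminf_le_const)
    show "(\<Sum>t<n. ennreal (\<integral>x. X t x \<partial>M)) \<le> ennreal K" for n
      using sum[of n] nonneg by (subst sum_ennreal) (auto intro!: ennreal_leI integral_nonneg_AE)
  qed simp
  finally have "(\<integral>\<^sup>+x. (\<Sum>t. ennreal (X t x)) \<partial>M) \<noteq> \<infinity>"
    using neq_top_trans by force
  then have "AE x in M. (\<Sum>t. ennreal (X t x)) \<noteq> \<infinity>"
    by (intro nn_integral_PInf_AE) auto
  then show ?thesis
    using AE_space
  proof eventually_elim
    case (elim x)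
    have "summable (\<lambda>t. X t x)"
      using elim by (intro summable_suminf_not_top) (auto simp: nonneg)
    then show ?case by (rule summable_LIMSEQ_zero)
  qed
qed

section \<open>Signal filtration and integration over the next signal\<close>

locale learning_signals = learning A S l \<theta>s \<mu>0 j0 + prob_space M
  for A :: "nat \<Rightarrow> real^'n::finite^'n" and S :: "'n \<Rightarrow> 's set"
    and l :: "'th::finite \<Rightarrow> ('n \<Rightarrow> 's) pmf" and \<theta>s \<mu>0 j0 and M :: "'a measure" +
  fixes \<omega> :: "nat \<Rightarrow> 'a \<Rightarrow> 'n \<Rightarrow> 's"
  assumes signals: "\<And>t x i. t \<ge> 1 \<Longrightarrow> x \<in> space M \<Longrightarrow> \<omega> t x i \<in> S i"
    and indep: "indep_vars (\<lambda>_. count_space UNIV) \<omega> {1..}"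
    and law: "\<And>t. t \<ge> 1 \<Longrightarrow> distr M (count_space UNIV) (\<omega> t) = measure_pmf (l \<theta>s)"
begin

abbreviation path :: "'a \<Rightarrow> nat \<Rightarrow> 'n \<Rightarrow> 's" where
  "path x \<equiv> \<lambda>t. \<omega> t x"

text \<open>Kept as a family of preimages, the form in which \<open>indep_vars_def2\<close> provides
  independence. The family is closed under intersection, as passing to generated sigma-algebras
  requires.\<close>

definition signal_events :: "nat \<Rightarrow> 'a set set" where
  "signal_events t = {\<omega> t -` X \<inter> space M | X. X \<in> sets (count_space UNIV)}"

definition F :: "nat \<Rightarrow> 'a measure" where
  "F t = sigma (space M) (\<Union>r\<in>{1..t}. signal_events r)"

lemma signal_eventsI: "\<omega> t -` X \<inter> space M \<in> signal_events t"
  unfolding signal_events_def by (intro CollectI exI[of _ X]) simp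

lemma admissible_path: "x \<in> space M \<Longrightarrow> admissible (path x)"
  using signals by (simp add: admissible_def)

lemma random_variable_\<omega>: "1 \<le> t \<Longrightarrow> \<omega> t \<in> measurable M (count_space UNIV)"
  using indep by (auto simp: indep_vars_def2)

lemma signal_events_sub: "1 \<le> t \<Longrightarrow> signal_events t \<subseteq> events"
  using random_variable_\<omega> by (auto simp: signal_events_def intro: measurable_sets)

lemma signal_events_Pow: "signal_events t \<subseteq> Pow (space M)"
  by (auto simp: signal_events_def)

lemma space_F [simp]: "space (F t) = space M"
  using signal_events_Pow by (simp add: F_def space_measure_of_conv)

lemma sets_F: "sets (F t) = sigma_sets (space M) (\<Union>r\<in>{1..t}. signal_events r)"
  unfolding F_def using signal_events_Pow by (intro sets_measure_of) blast

lemma subalgebra_F: "subalgebra M (F t)"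
  unfolding subalgebra_def sets_F
  using signal_events_sub by (intro conjI sets.sigma_sets_subset UN_least) (auto simp: space_F)

lemma sets_F_mono: "s \<le> t \<Longrightarrow> sets (F s) \<subseteq> sets (F t)"
  unfolding sets_F by (intro sigma_sets_mono' UN_mono) auto

lemma measurable_F_mono: "f \<in> measurable (F s) N \<Longrightarrow> s \<le> t \<Longrightarrow> f \<in> measurable (F t) N"
  using sets_F_mono[of s t] by (auto simp: measurable_def)

lemma measurable_F_M: "f \<in> measurable (F t) N \<Longrightarrow> f \<in> measurable M N"
  using measurable_from_subalg[OF subalgebra_F] .

lemma measurable_\<omega>_F: "1 \<le> t \<Longrightarrow> \<omega> t \<in> measurable (F t) (count_space UNIV)"
  unfolding measurable_def sets_F by (auto intro!: sigma_sets.Basic bexI[of _ t] signal_eventsI)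

text \<open>The index blocks \<open>{1..t}\<close> and \<open>{Suc t}\<close> are disjoint, so they
  generate independent sigma-algebras. Only one coordinate of the next profile enters.\<close>

lemma indep_next:
  assumes f: "f \<in> borel_measurable (F t)"
  shows "indep_var borel f borel (\<lambda>x. if \<omega> (Suc t) x i = u then 1 else 0 :: real)"
proof -
  let ?g = "\<lambda>x. if \<omega> (Suc t) x i = u then 1 else 0 :: real"
  let ?I = "case_bool {1..t} {Suc t}"
  have "indep_sets signal_events {1..}"
    using indep unfolding indep_vars_def2 signal_events_def by blast
  then have "indep_sets signal_events (\<Union>j. ?I j)"
    by (rule indep_sets_mono_index[rotated]) (auto split: bool.splits)
  then have "indep_sets (\<lambda>j. sigma_sets (space M) (\<Union>i\<in>?I j. signal_events i)) UNIV"
  proof (rule indep_sets_collect_sigma)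
    show "Int_stable (signal_events i)" for i
      unfolding Int_stable_def signal_events_def
      by (auto, rule_tac x="X \<inter> Xa" in exI, auto)
  qed (auto simp: disjoint_family_on_def split: bool.splits)
  then have ind: "indep_set (sets (F t)) (sigma_sets (space M) (signal_events (Suc t)))"
    unfolding indep_set_def sets_F
    by (rule iffD1[OF indep_sets_cong, rotated -1]) (auto split: bool.splits)
  have g: "?g \<in> measurable M borel"
    by (rule measurable_compose[OF random_variable_\<omega>[of "Suc t"], of "\<lambda>s. if s i = u then 1 else 0"]) auto
  have "indep_set (sigma_sets (space M) {f -` X \<inter> space M |X. X \<in> sets borel})
     (sigma_sets (space M) {?g -` X \<inter> space M |X. X \<in> sets borel})"
    using ind unfolding indep_set_def
  proof (rule indep_sets_mono_sets)
    fix j :: bool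
    have "sigma_sets (space M) {f -` X \<inter> space M |X. X \<in> sets borel} \<subseteq> sets (F t)"
      using measurable_sets[OF f] sets.sigma_sets_subset[of "{f -` X \<inter> space M |X. X \<in> sets borel}" "F t"] by auto
    moreover have "{?g -` X \<inter> space M |X. X \<in> sets borel} \<subseteq> signal_events (Suc t)"
    proof
      fix E assume "E \<in> {?g -` X \<inter> space M |X. X \<in> sets borel}"
      then obtain X where "E = ?g -` X \<inter> space M" by blast
      then have "E = \<omega> (Suc t) -` {s. (if s i = u then 1 else 0 :: real) \<in> X} \<inter> space M" by auto
      then show "E \<in> signal_events (Suc t)" by (simp only: signal_eventsI)
    qed
    then have "sigma_sets (space M) {?g -` X \<inter> space M |X. X \<in> sets borel} \<subseteq>
        sigma_sets (space M) (signal_events (Suc t))" by (rule sigma_sets_mono')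
    ultimately show "case_bool (sigma_sets (space M) {f -` X \<inter> space M |X. X \<in> sets borel})
     (sigma_sets (space M) {?g -` X \<inter> space M |X. X \<in> sets borel}) j \<subseteq>
     case_bool (sets (F t)) (sigma_sets (space M) (signal_events (Suc t))) j"
      by (cases j) simp_all
  qed
  then show ?thesis
    unfolding indep_var_eq using measurable_F_M[OF f] g by blast
qed

lemma expectation_next_indicator:
  "(\<integral>x. (if \<omega> (Suc t) x i = u then 1 else 0 :: real) \<partial>M) = lik i \<theta>s u"
proof -
  have "(\<integral>x. (if \<omega> (Suc t) x i = u then 1 else 0 :: real) \<partial>M)
      = (\<integral>s. (if s i = u then 1 else 0 :: real) \<partial>distr M (count_space UNIV) (\<omega> (Suc t)))"
    using random_variable_\<omega>[of "Suc t"] by (subst integral_distr) auto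
  also have "\<dots> = (\<integral>s. indicator {s. s i = u} s \<partial>measure_pmf (l \<theta>s))"
    using law[of "Suc t"] by (intro Bochner_Integration.integral_cong) (auto split: split_indicator)
  also have "\<dots> = lik i \<theta>s u"
    by (simp add: marginal_def pmf_map vimage_def)
  finally show ?thesis .
qed

text \<open>An algebra of functions that delivers measurability with respect to the past and
  integrability together; every integrand below is built inside it.\<close>

definition bounded_adapted :: "nat \<Rightarrow> ('a \<Rightarrow> real) \<Rightarrow> bool" where
  "bounded_adapted t f \<longleftrightarrow> f \<in> borel_measurable (F t) \<and> (\<exists>K. \<forall>x\<in>space M. \<bar>f x\<bar> \<le> K)"

lemma bounded_adaptedI:
  "f \<in> borel_measurable (F t) \<Longrightarrow> (\<And>x. x \<in> space M \<Longrightarrow> \<bar>f x\<bar> \<le> K) \<Longrightarrow> bounded_adapted t f"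
  by (auto simp: bounded_adapted_def)

lemma bounded_adaptedD: "bounded_adapted t f \<Longrightarrow> f \<in> borel_measurable (F t)"
  by (simp add: bounded_adapted_def)

lemma bounded_adapted_integrable: "bounded_adapted t f \<Longrightarrow> integrable M f"
  unfolding bounded_adapted_def
  using measurable_F_M by (auto intro!: integrable_const_bound AE_I2)

lemma bounded_adapted_const: "bounded_adapted t (\<lambda>_. r)"
  by (rule bounded_adaptedI[of _ _ "\<bar>r\<bar>"]) auto

lemma bounded_adapted_indicator: "H \<in> sets (F t) \<Longrightarrow> bounded_adapted t (indicator H)"
  by (rule bounded_adaptedI[of _ _ 1]) (auto split: split_indicator)

lemma bounded_adapted_add:
  assumes "bounded_adapted t f" "bounded_adapted t g"
  shows "bounded_adapted t (\<lambda>x. f x + g x)"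
proof -
  obtain K L where "\<forall>x\<in>space M. \<bar>f x\<bar> \<le> K" "\<forall>x\<in>space M. \<bar>g x\<bar> \<le> L"
    using assms by (auto simp: bounded_adapted_def)
  then have "\<bar>f x + g x\<bar> \<le> K + L" if "x \<in> space M" for x
    using that abs_triangle_ineq[of "f x" "g x"] by force
  moreover have "(\<lambda>x. f x + g x) \<in> borel_measurable (F t)"
    using assms[THEN bounded_adaptedD] by measurable
  ultimately show ?thesis by (intro bounded_adaptedI)
qed

lemma bounded_adapted_mult:
  assumes "bounded_adapted t f" "bounded_adapted t g"
  shows "bounded_adapted t (\<lambda>x. f x * g x)"
proof -
  obtain K L where KL: "\<forall>x\<in>space M. \<bar>f x\<bar> \<le> K" "\<forall>x\<in>space M. \<bar>g x\<bar> \<le> L"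
    using assms by (auto simp: bounded_adapted_def)
  have "\<bar>f x * g x\<bar> \<le> K * L" if "x \<in> space M" for x
  proof -
    have "\<bar>f x\<bar> \<le> K" "\<bar>g x\<bar> \<le> L" using KL that by auto
    then show ?thesis unfolding abs_mult by (intro mult_mono) auto
  qed
  moreover have "(\<lambda>x. f x * g x) \<in> borel_measurable (F t)"
    using assms[THEN bounded_adaptedD] by measurable
  ultimately show ?thesis by (intro bounded_adaptedI)
qed

lemma bounded_adapted_diff:
  assumes "bounded_adapted t f" "bounded_adapted t g"
  shows "bounded_adapted t (\<lambda>x. f x - g x)"
  using bounded_adapted_add[OF assms(1) bounded_adapted_mult[OF bounded_adapted_const[of t "-1"] assms(2)]]
  by simp

lemma bounded_adapted_sum:
  assumes "\<And>k. k \<in> I \<Longrightarrow> bounded_adapted t (f k)"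
  shows "bounded_adapted t (\<lambda>x. \<Sum>k\<in>I. f k x)"
  using assms
  by (induction I rule: infinite_finite_induct) (auto intro: bounded_adapted_add bounded_adapted_const)

lemma bounded_adapted_divide:
  assumes f: "bounded_adapted t f" and g: "bounded_adapted t g"
    and low: "0 < \<kappa>" "\<And>x. x \<in> space M \<Longrightarrow> \<kappa> \<le> g x"
  shows "bounded_adapted t (\<lambda>x. f x / g x)"
proof -
  have "bounded_adapted t (\<lambda>x. inverse (g x))"
  proof (rule bounded_adaptedI)
    show "(\<lambda>x. inverse (g x)) \<in> borel_measurable (F t)" using bounded_adaptedD[OF g] by measurable
    show "\<bar>inverse (g x)\<bar> \<le> inverse \<kappa>" if "x \<in> space M" for x
      using low(1) low(2)[OF that] by (simp add: le_imp_inverse_le)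
  qed
  from bounded_adapted_mult[OF f this] show ?thesis by (simp add: divide_inverse)
qed

lemma bounded_adapted_mono: "bounded_adapted s f \<Longrightarrow> s \<le> t \<Longrightarrow> bounded_adapted t f"
  using measurable_F_mono by (auto simp: bounded_adapted_def)

lemmas bounded_adapted_intros = bounded_adapted_const bounded_adapted_indicator bounded_adapted_add
  bounded_adapted_mult bounded_adapted_diff bounded_adapted_sum

text \<open>With finitely many signals, dependence on the next one becomes a sum of past
  coefficients times indicators, so that independence of two real variables is enough.\<close>

lemma next_signal_sum:
  assumes "x \<in> space M"
  shows "h (\<omega> (Suc t) x i) x = (\<Sum>u\<in>S i. h u x * (if \<omega> (Suc t) x i = u then 1 else 0 :: real))"
proof -
  have "(\<Sum>u\<in>S i. h u x * (if \<omega> (Suc t) x i = u then 1 else 0)) =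
      (\<Sum>u\<in>S i. if \<omega> (Suc t) x i = u then h u x else 0)"
    by (intro sum.cong) auto
  also have "\<dots> = h (\<omega> (Suc t) x i) x"
    using signals[OF _ assms, of "Suc t" i] finite_S by (subst sum.delta') auto
  finally show ?thesis by simp
qed

text \<open>Averaging over the next signal replaces conditional expectations given \<open>F t\<close>.\<close>

lemma expectation_next:
  assumes h: "\<And>u. u \<in> S i \<Longrightarrow> bounded_adapted t (h u)"
  shows "(\<integral>x. h (\<omega> (Suc t) x i) x \<partial>M) = (\<Sum>u\<in>S i. lik i \<theta>s u * (\<integral>x. h u x \<partial>M))"
proof -
  let ?e = "\<lambda>u x. if \<omega> (Suc t) x i = u then 1 else 0 :: real"
  have e: "integrable M (?e u)" for u
  proof (rule integrable_const_bound[of _ 1])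
    show "?e u \<in> borel_measurable M"
      by (rule measurable_compose[OF random_variable_\<omega>[of "Suc t"], of "\<lambda>s. if s i = u then 1 else 0"]) auto
  qed auto
  note iv = indep_next[OF bounded_adaptedD[OF h]]
  have "(\<integral>x. h (\<omega> (Suc t) x i) x \<partial>M) = (\<integral>x. (\<Sum>u\<in>S i. h u x * ?e u x) \<partial>M)"
    by (intro Bochner_Integration.integral_cong refl next_signal_sum)
  also have "\<dots> = (\<Sum>u\<in>S i. \<integral>x. h u x * ?e u x \<partial>M)"
    by (rule Bochner_Integration.integral_sum, rule indep_var_integrable[OF iv])
      (auto intro: bounded_adapted_integrable h e)
  also have "\<dots> = (\<Sum>u\<in>S i. lik i \<theta>s u * (\<integral>x. h u x \<partial>M))"
  proof (rule sum.cong)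
    fix u assume u: "u \<in> S i"
    have "(\<integral>x. h u x * ?e u x \<partial>M) = (\<integral>x. h u x \<partial>M) * (\<integral>x. ?e u x \<partial>M)"
      by (rule indep_var_lebesgue_integral[OF iv]) (auto intro: bounded_adapted_integrable h e u)
    then show "(\<integral>x. h u x * ?e u x \<partial>M) = lik i \<theta>s u * (\<integral>x. h u x \<partial>M)"
      by (simp only: expectation_next_indicator mult.commute)
  qed simp
  finally show ?thesis .
qed

end

section \<open>Adaptedness of beliefs and mean drift of likelihood ratios\<close>

context learning_signals
begin

lemma bounded_adapted_lik: "bounded_adapted (Suc t) (\<lambda>x. lik i \<theta> (\<omega> (Suc t) x i))"
  by (rule bounded_adaptedI[of _ _ 1], rule measurable_compose[OF measurable_\<omega>_F[of "Suc t"]])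
    (auto simp: pmf_le_1)

lemma bounded_adapted_bel: "bounded_adapted t (\<lambda>x. bel (path x) t i \<theta>)"
proof (rule bounded_adaptedI)
  show "\<bar>bel (path x) t i \<theta>\<bar> \<le> 1" if "x \<in> space M" for x
    using belD[OF admissible_path[OF that]] by simp
  show "(\<lambda>x. bel (path x) t i \<theta>) \<in> borel_measurable (F t)"
  proof (induction t arbitrary: i \<theta>)
    case (Suc t)
    have [measurable]: "(\<lambda>x. bel (path x) t j \<theta>') \<in> borel_measurable (F (Suc t))" for j \<theta>'
      using measurable_F_mono[OF Suc] by simp
    have [measurable]: "(\<lambda>x. lik j \<theta>' (\<omega> (Suc t) x j)) \<in> borel_measurable (F (Suc t))" for j \<theta>'
      using bounded_adapted_lik by (rule bounded_adaptedD)
    show ?case unfolding belief.simps by measurable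
  qed simp
qed

lemma bounded_adapted_mix:
  "(\<And>\<theta>. bounded_adapted t (\<lambda>x. \<beta> x \<theta>)) \<Longrightarrow> bounded_adapted t (\<lambda>x. mix i (\<beta> x) u)"
  unfolding mix_def by (intro bounded_adapted_intros)

lemma bounded_adapted_divide_mix:
  assumes "bounded_adapted t f" "\<And>\<theta>. bounded_adapted t (\<lambda>x. \<beta> x \<theta>)"
    "\<And>x. x \<in> space M \<Longrightarrow> prob_vector (\<beta> x)" "u \<in> S i"
  shows "bounded_adapted t (\<lambda>x. f x / mix i (\<beta> x) u)"
proof -
  obtain c where c: "0 < c" "c \<le> 1" "\<And>i \<theta> u. u \<in> S i \<Longrightarrow> c \<le> lik i \<theta> u" by (fact lik_bound)
  show ?thesis
    by (rule bounded_adapted_divide[OF assms(1) bounded_adapted_mix c(1)]) (use assms c mix_ge in auto)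
qed

lemma bounded_adapted_chi2:
  assumes "\<And>\<theta>. bounded_adapted t (\<lambda>x. \<beta> x \<theta>)" "\<And>x. x \<in> space M \<Longrightarrow> prob_vector (\<beta> x)"
  shows "bounded_adapted t (\<lambda>x. chi2 i (\<beta> x))"
  unfolding chi2_def power2_eq_square
  by (intro bounded_adapted_intros bounded_adapted_divide_mix bounded_adapted_mix assms)

lemma prob_vector_path: "x \<in> space M \<Longrightarrow> prob_vector (bel (path x) t i)"
  by (intro prob_vector_bel admissible_path)

lemma bounded_adapted_update:
  "u \<in> S i \<Longrightarrow> bounded_adapted t (\<lambda>x. update t i u (bel (path x) t) \<theta>)"
  unfolding update_def
  by (intro bounded_adapted_intros bounded_adapted_divide_mix bounded_adapted_bel prob_vector_path)

lemma bounded_adapted_next: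
  assumes "\<And>u. u \<in> S i \<Longrightarrow> bounded_adapted t (h u)"
  shows "bounded_adapted (Suc t) (\<lambda>x. h (\<omega> (Suc t) x i) x)"
proof -
  have "bounded_adapted (Suc t) (\<lambda>x. if \<omega> (Suc t) x i = u then 1 else 0)" for u
    by (rule bounded_adaptedI[of _ _ 1], rule measurable_compose[OF measurable_\<omega>_F[of "Suc t"], of "\<lambda>s. if s i = u then 1 else 0"])
      auto
  then have "bounded_adapted (Suc t) (\<lambda>x. \<Sum>u\<in>S i. h u x * (if \<omega> (Suc t) x i = u then 1 else 0))"
    using assms by (intro bounded_adapted_intros) (auto intro: bounded_adapted_mono[of t])
  then show ?thesis
    unfolding bounded_adapted_def
    by (subst measurable_cong[OF next_signal_sum]) (auto simp: next_signal_sum[of _ h])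
qed

lemma bounded_adapted_drift_truth:
  "bounded_adapted t g \<Longrightarrow> u \<in> S i \<Longrightarrow>
    bounded_adapted t (\<lambda>x. g x * (lik i \<theta>s u / mix i (bel (path x) t i) u - 1))"
  by (intro bounded_adapted_intros bounded_adapted_divide_mix bounded_adapted_bel prob_vector_path)

lemma bounded_adapted_drift_inverse:
  assumes "bounded_adapted t g" "u \<in> S i"
  shows "bounded_adapted t (\<lambda>x. g x * (mix i (bel (path x) t i) u / lik i \<theta>s u - 1))"
  unfolding divide_inverse
  by (intro bounded_adapted_intros bounded_adapted_mix bounded_adapted_bel assms)

text \<open>Given the past, the signal of \<open>i\<close> has law \<open>lik i \<theta>s\<close>,
  so \<open>chi2_eq\<close> gives the mean ratio. The factor \<open>g\<close> later carries the test
  event, the weights and the current belief.\<close>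

lemma drift_truth:
  assumes g: "bounded_adapted t g"
  shows "(\<integral>x. g x * (lik i \<theta>s (\<omega> (Suc t) x i) / mix i (bel (path x) t i) (\<omega> (Suc t) x i) - 1) \<partial>M)
    = (\<integral>x. g x * chi2 i (bel (path x) t i) \<partial>M)"
proof -
  let ?h = "\<lambda>u x. g x * (lik i \<theta>s u / mix i (bel (path x) t i) u - 1)"
  have "(\<integral>x. ?h (\<omega> (Suc t) x i) x \<partial>M) = (\<Sum>u\<in>S i. lik i \<theta>s u * (\<integral>x. ?h u x \<partial>M))"
    by (rule expectation_next) (rule bounded_adapted_drift_truth[OF g])
  also have "\<dots> = (\<integral>x. (\<Sum>u\<in>S i. lik i \<theta>s u * ?h u x) \<partial>M)"
    by (subst Bochner_Integration.integral_sum)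
      (auto intro!: integrable_mult_right bounded_adapted_integrable bounded_adapted_drift_truth g)
  also have "\<dots> = (\<integral>x. g x * chi2 i (bel (path x) t i) \<partial>M)"
  proof (rule Bochner_Integration.integral_cong)
    fix x assume x: "x \<in> space M"
    have "(\<Sum>u\<in>S i. lik i \<theta>s u * ?h u x) =
        g x * (\<Sum>u\<in>S i. lik i \<theta>s u * (lik i \<theta>s u / mix i (bel (path x) t i) u - 1))"
      by (simp add: sum_distrib_left mult_ac)
    then show "(\<Sum>u\<in>S i. lik i \<theta>s u * ?h u x) = g x * chi2 i (bel (path x) t i)"
      using chi2_eq[OF prob_vector_path[OF x]] by simp
  qed simp
  finally show ?thesis .
qed

text \<open>Weighting the inverted ratio by the true likelihood cancels it and leaves the forecast,
  which sums to 1.\<close>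

lemma drift_inverse:
  assumes g: "bounded_adapted t g"
  shows "(\<integral>x. g x * (mix i (bel (path x) t i) (\<omega> (Suc t) x i) / lik i \<theta>s (\<omega> (Suc t) x i) - 1) \<partial>M) = 0"
proof -
  let ?h = "\<lambda>u x. g x * (mix i (bel (path x) t i) u / lik i \<theta>s u - 1)"
  have "(\<integral>x. ?h (\<omega> (Suc t) x i) x \<partial>M) = (\<Sum>u\<in>S i. lik i \<theta>s u * (\<integral>x. ?h u x \<partial>M))"
    by (rule expectation_next) (rule bounded_adapted_drift_inverse[OF g])
  also have "\<dots> = (\<integral>x. (\<Sum>u\<in>S i. lik i \<theta>s u * ?h u x) \<partial>M)"
    by (subst Bochner_Integration.integral_sum)
      (auto intro!: integrable_mult_right bounded_adapted_integrable bounded_adapted_drift_inverse g)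
  also have "\<dots> = (\<integral>x. 0 \<partial>M)"
  proof (rule Bochner_Integration.integral_cong)
    fix x assume x: "x \<in> space M"
    have "(\<Sum>u\<in>S i. lik i \<theta>s u * ?h u x) = (\<Sum>u\<in>S i. g x * (mix i (bel (path x) t i) u - lik i \<theta>s u))"
      using positive by (intro sum.cong) (auto simp: field_simps order_less_imp_not_eq2)
    also have "\<dots> = 0"
      by (simp add: sum_subtractf mix_sum[OF prob_vector_path[OF x]] lik_sum flip: sum_distrib_left)
    finally show "(\<Sum>u\<in>S i. lik i \<theta>s u * ?h u x) = 0" .
  qed simp
  finally show ?thesis by simp
qed

end

text \<open>Jensen's inequality for the reciprocal, from its tangent at the weighted mean
  \<open>X\<close>: \<open>1 / x\<close> lies above \<open>2 / X - x / X\<^sup>2\<close>.\<close>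

lemma inverse_weighted_mean_le:
  fixes a x :: "'b \<Rightarrow> real"
  assumes "finite I" "\<And>j. j \<in> I \<Longrightarrow> 0 \<le> a j" "sum a I = 1" "\<And>j. j \<in> I \<Longrightarrow> 0 < x j"
  shows "1 / (\<Sum>j\<in>I. a j * x j) \<le> (\<Sum>j\<in>I. a j / x j)"
proof -
  define X where "X = (\<Sum>j\<in>I. a j * x j)"
  obtain k where k: "k \<in> I" "a k \<noteq> 0" using assms(3) by (metis sum.neutral zero_neq_one)
  have "0 < X"
    unfolding X_def using assms k by (intro sum_pos2[of I k]) (auto simp: less_le)
  have tangent: "a j * (2 / X - x j / X\<^sup>2) \<le> a j / x j" if "j \<in> I" for j
  proof -
    have "0 \<le> (X - x j)\<^sup>2 / (x j * X\<^sup>2)" using assms that \<open>0 < X\<close> by (intro divide_nonneg_nonneg) (auto simp: less_imp_le)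
    also have "\<dots> = 1 / x j - (2 / X - x j / X\<^sup>2)"
      using assms(4)[OF that] \<open>0 < X\<close> by (simp add: field_simps power2_eq_square)
    finally have "2 / X - x j / X\<^sup>2 \<le> 1 / x j" by simp
    from mult_left_mono[OF this assms(2)[OF that]] show ?thesis by simp
  qed
  have "1 / X = 2 / X - X / X\<^sup>2" using \<open>0 < X\<close> by (simp add: field_simps power2_eq_square)
  also have "\<dots> = (\<Sum>j\<in>I. a j) * (2 / X) - (\<Sum>j\<in>I. a j * x j) / X\<^sup>2" using assms(3) by (simp add: X_def)
  also have "\<dots> = (\<Sum>j\<in>I. a j * (2 / X - x j / X\<^sup>2))"
    by (simp add: sum_distrib_right sum_divide_distrib right_diff_distrib sum_subtractf)
  also have "\<dots> \<le> (\<Sum>j\<in>I. a j / x j)" by (intro sum_mono tangent)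
  finally show ?thesis by (simp add: X_def)
qed

text \<open>Jensen applied to the neighbours' beliefs with the entry of \<open>i\<close> replaced by
  its posterior. The last term is the one whose mean \<open>drift_inverse\<close> shows to be
  zero.\<close>

lemma (in learning) inverse_update_le:
  assumes \<beta>: "\<And>j. prob_vector (\<beta> j)" and u: "u \<in> S i" and pos: "\<And>j. 0 < \<beta> j \<theta>"
  shows "1 / update t i u \<beta> \<theta> \<le> (\<Sum>j\<in>UNIV. A t $ i $ j * (1 / \<beta> j \<theta>))
    + A t $ i $ i * (1 / \<beta> i \<theta>) * (mix i (\<beta> i) u / lik i \<theta> u - 1)"
proof -
  define x where "x j = (if j = i then lik i \<theta> u * \<beta> i \<theta> / mix i (\<beta> i) u else \<beta> j \<theta>)" for j
  have m: "0 < mix i (\<beta> i) u" using mix_pos \<beta> u by blast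
  have x: "0 < x j" for j using pos positive[OF u] m by (simp add: x_def)
  have split: "(\<Sum>j\<in>UNIV. f j) = f i + (\<Sum>j\<in>UNIV - {i}. f j)" for f :: "'n \<Rightarrow> real"
    by (rule sum.remove) auto
  have "(\<Sum>j\<in>UNIV - {i}. A t $ i $ j * x j) = (\<Sum>j\<in>UNIV - {i}. A t $ i $ j * \<beta> j \<theta>)"
    by (intro sum.cong) (auto simp: x_def)
  then have "update t i u \<beta> \<theta> = (\<Sum>j\<in>UNIV. A t $ i $ j * x j)"
    unfolding update_def split[of "\<lambda>j. A t $ i $ j * x j"] by (simp add: x_def)
  also have "1 / \<dots> \<le> (\<Sum>j\<in>UNIV. A t $ i $ j / x j)"
    by (rule inverse_weighted_mean_le) (auto simp: x)
  also have "\<dots> = A t $ i $ i * (mix i (\<beta> i) u / (lik i \<theta> u * \<beta> i \<theta>)) + (\<Sum>j\<in>UNIV - {i}. A t $ i $ j * (1 / \<beta> j \<theta>))"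
    unfolding split[of "\<lambda>j. A t $ i $ j / x j"] by (auto simp: x_def intro!: sum.cong)
  also have "\<dots> = (\<Sum>j\<in>UNIV. A t $ i $ j * (1 / \<beta> j \<theta>))
      + A t $ i $ i * (1 / \<beta> i \<theta>) * (mix i (\<beta> i) u / lik i \<theta> u - 1)"
    unfolding split[of "\<lambda>j. A t $ i $ j * (1 / \<beta> j \<theta>)"] by (simp add: right_diff_distrib mult.commute)
  finally show ?thesis .
qed

section \<open>Supermartingales weighted by the absolute probability sequence\<close>

context learning_signals
begin

context
  fixes \<pi> :: "nat \<Rightarrow> 'n \<Rightarrow> real" and p :: real
  assumes p_pos: "0 < p" and \<pi>_ge: "\<And>t i. p \<le> \<pi> t i" and \<pi>_sum: "\<And>t. (\<Sum>i\<in>UNIV. \<pi> t i) = 1"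
    and \<pi>_step: "\<And>t j. \<pi> t j = (\<Sum>i\<in>UNIV. \<pi> (Suc t) i * A t $ i $ j)"
begin

lemma \<pi>_nonneg: "0 \<le> \<pi> t i"
  using p_pos \<pi>_ge[of t i] by simp

text \<open>In the weighted mean the averaging over neighbours disappears, so only the innovations
  contribute to the drift.\<close>

lemma \<pi>_average: "(\<Sum>i\<in>UNIV. \<pi> (Suc t) i * (\<Sum>j\<in>UNIV. A t $ i $ j * f j)) = (\<Sum>j\<in>UNIV. \<pi> t j * f j)"
  unfolding \<pi>_step[of t] sum_distrib_left sum_distrib_right
  by (subst sum.swap) (simp add: mult.assoc)

lemma AE_truth_bounded_below:
  "AE x in M. \<exists>\<epsilon>>0. \<forall>\<^sub>F t in sequentially. \<forall>j. \<epsilon> \<le> bel (path x) t j \<theta>s"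
proof -
  obtain \<eta> \<kappa> T where "0 < \<eta>" "0 < \<kappa>" and low: "\<And>w k i. admissible w \<Longrightarrow> \<eta> * \<kappa> ^ k \<le> bel w (T + k) i \<theta>s"
    by (fact truth_pos)
  have low_pos: "0 < \<eta> * \<kappa> ^ k" for k using \<open>0 < \<eta>\<close> \<open>0 < \<kappa>\<close> by simp
  have inv: "bounded_adapted (T + k) (\<lambda>x. 1 / bel (path x) (T + k) i \<theta>s)" for k i
    by (rule bounded_adapted_divide[OF bounded_adapted_const bounded_adapted_bel low_pos])
      (rule low[OF admissible_path])
  define Z where "Z k x = (\<Sum>i\<in>UNIV. \<pi> (T + k) i * (1 / bel (path x) (T + k) i \<theta>s))" for k x
  have Z: "bounded_adapted (T + k) (Z k)" for k
    unfolding Z_def by (intro bounded_adapted_intros inv)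
  have b_pos: "0 < bel (path x) (T + k) i \<theta>s" if "x \<in> space M" for x k i
    using low[OF admissible_path[OF that], of k i] low_pos[of k] by linarith
  have "AE x in M. convergent (\<lambda>k. Z k x)"
  proof (rule nonneg_supermartingale_convergent)
    show "subalgebra M (F (T + k))" for k by (rule subalgebra_F)
    show "sets (F (T + k)) \<subseteq> sets (F (T + Suc k))" for k by (rule sets_F_mono) simp
    show "Z k \<in> borel_measurable (F (T + k))" for k using Z by (rule bounded_adaptedD)
    show "integrable M (Z k)" for k using Z by (rule bounded_adapted_integrable)
    show "0 \<le> Z k x" if "x \<in> space M" for k x
      unfolding Z_def using b_pos[OF that] \<pi>_nonneg by (intro sum_nonneg mult_nonneg_nonneg) (auto simp: less_imp_le)
    fix k H assume H: "H \<in> sets (F (T + k))"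
    let ?t = "T + k"
    define g where "g i x = indicator H x * (\<pi> (Suc ?t) i * A ?t $ i $ i * (1 / bel (path x) ?t i \<theta>s))" for i x
    have g: "bounded_adapted ?t (g i)" for i
      unfolding g_def by (intro bounded_adapted_intros inv H)
    define d where "d i x = g i x * (mix i (bel (path x) ?t i) (\<omega> (Suc ?t) x i) / lik i \<theta>s (\<omega> (Suc ?t) x i) - 1)" for i x
    have d_int: "integrable M (d i)" for i
      unfolding d_def
      by (rule bounded_adapted_integrable,
          rule bounded_adapted_next[of i ?t "\<lambda>u x. g i x * (mix i (bel (path x) ?t i) u / lik i \<theta>s u - 1)"],
          rule bounded_adapted_drift_inverse[OF g])
    have HM: "H \<in> sets M" using H subalgebra_F by (auto simp: subalgebra_def)
    have Z_int: "integrable M (\<lambda>x. indicator H x * Z m x)" for m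
      using integrable_real_mult_indicator[OF HM bounded_adapted_integrable[OF Z[of m]]] by (simp add: mult.commute)
    have "indicator H x * Z (Suc k) x \<le> indicator H x * Z k x + (\<Sum>i\<in>UNIV. d i x)" if x: "x \<in> space M" for x
    proof -
      let ?D = "\<lambda>i. A ?t $ i $ i * (1 / bel (path x) ?t i \<theta>s) *
            (mix i (bel (path x) ?t i) (\<omega> (Suc ?t) x i) / lik i \<theta>s (\<omega> (Suc ?t) x i) - 1)"
      have "Z (Suc k) x \<le> (\<Sum>i\<in>UNIV. \<pi> (Suc ?t) i *
          ((\<Sum>j\<in>UNIV. A ?t $ i $ j * (1 / bel (path x) ?t j \<theta>s)) + ?D i))"
        unfolding Z_def add_Suc_right belief_Suc
        by (intro sum_mono mult_left_mono inverse_update_le prob_vector_path x \<pi>_nonneg b_pos)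
          (use signals x in auto)
      also have "\<dots> = Z k x + (\<Sum>i\<in>UNIV. \<pi> (Suc ?t) i * ?D i)"
        by (simp only: distrib_left sum.distrib \<pi>_average Z_def)
      finally have "indicator H x * Z (Suc k) x \<le> indicator H x * (Z k x + (\<Sum>i\<in>UNIV. \<pi> (Suc ?t) i * ?D i))"
        by (intro mult_left_mono) auto
      then show ?thesis by (simp add: d_def g_def distrib_left sum_distrib_left mult_ac)
    qed
    then have "(\<integral>x. indicator H x * Z (Suc k) x \<partial>M) \<le> (\<integral>x. indicator H x * Z k x + (\<Sum>i\<in>UNIV. d i x) \<partial>M)"
      by (intro integral_mono Bochner_Integration.integrable_add Bochner_Integration.integrable_sum Z_int d_int)
    also have "\<dots> = (\<integral>x. indicator H x * Z k x \<partial>M) + (\<Sum>i\<in>UNIV. \<integral>x. d i x \<partial>M)"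
      by (simp add: Z_int d_int)
    also have "(\<Sum>i\<in>UNIV. \<integral>x. d i x \<partial>M) = 0"
      unfolding d_def by (intro sum.neutral ballI drift_inverse g)
    finally show "(\<integral>x. indicator H x * Z (Suc k) x \<partial>M) \<le> (\<integral>x. indicator H x * Z k x \<partial>M)" by simp
  qed
  then show ?thesis
    using AE_space
  proof eventually_elim
    case (elim x)
    then obtain K where K: "0 < K" "\<And>k. norm (Z k x) \<le> K"
      using convergent_imp_Bseq BseqE by metis
    \<comment> \<open>A convergent sequence is bounded, and each single term
      \<open>\<pi> / bel\<close> is at most the sum \<open>Z k x\<close>; the lower bound
      \<open>p\<close> on the weights makes the estimate the same for all agents and times.\<close>
    have "p / K \<le> bel (path x) (T + k) i \<theta>s" for k i
    proof -
      have b: "0 < bel (path x) (T + k) i \<theta>s" using b_pos elim by blast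
      have "p / bel (path x) (T + k) i \<theta>s \<le> \<pi> (T + k) i * (1 / bel (path x) (T + k) i \<theta>s)"
        using \<pi>_ge[of "T + k" i] b by (simp add: divide_right_mono)
      also have "\<dots> \<le> Z k x"
        unfolding Z_def using b_pos[OF elim(2), of k] \<pi>_nonneg
        by (intro member_le_sum) (auto intro!: mult_nonneg_nonneg divide_nonneg_nonneg simp: less_imp_le)
      also have "\<dots> \<le> K" using K(2)[of k] by simp
      finally show ?thesis using b K(1) by (simp add: field_simps)
    qed
    then have "\<forall>\<^sub>F t in sequentially. \<forall>j. p / K \<le> bel (path x) t j \<theta>s"
      unfolding eventually_sequentially by (metis le_add_diff_inverse)
    then show ?case using p_pos K(1) by (intro exI[of _ "p / K"]) simp
  qed
qed

lemma bounded_adapted_bel_chi2: "bounded_adapted t (\<lambda>x. bel (path x) t i \<theta> * chi2 i (bel (path x) t i))"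
  by (intro bounded_adapted_intros bounded_adapted_bel bounded_adapted_chi2 prob_vector_path)

text \<open>No agent can tell \<open>\<theta>\<close> from \<open>\<theta>s\<close>, so the
  innovation of \<open>\<theta>\<close> has the true likelihood in its numerator and
  \<open>drift_truth\<close> applies. General \<open>H\<close> yields the submartingale property,
  \<open>H = space M\<close> the summability of the drift.\<close>

lemma average_belief_drift:
  assumes \<theta>: "\<theta> \<in> (\<Inter>i. equivalent_states l \<theta>s i)" and H: "H \<in> sets (F t)"
  shows "(\<integral>x. indicator H x * (\<Sum>i\<in>UNIV. \<pi> (Suc t) i * bel (path x) (Suc t) i \<theta>) \<partial>M)
    = (\<integral>x. indicator H x * (\<Sum>i\<in>UNIV. \<pi> t i * bel (path x) t i \<theta>) \<partial>M)
      + (\<Sum>i\<in>UNIV. \<pi> (Suc t) i * A t $ i $ i *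
          (\<integral>x. indicator H x * (bel (path x) t i \<theta> * chi2 i (bel (path x) t i)) \<partial>M))"
proof -
  have lik_eq: "lik i \<theta> u = lik i \<theta>s u" for i u using \<theta> by (simp add: equivalent_states_def)
  define Y where "Y t x = (\<Sum>i\<in>UNIV. \<pi> t i * bel (path x) t i \<theta>)" for t x
  define g where "g i x = indicator H x * (\<pi> (Suc t) i * A t $ i $ i * bel (path x) t i \<theta>)" for i x
  define d where "d i x = g i x * (lik i \<theta>s (\<omega> (Suc t) x i) / mix i (bel (path x) t i) (\<omega> (Suc t) x i) - 1)" for i x
  have g: "bounded_adapted t (g i)" for i
    unfolding g_def by (intro bounded_adapted_intros bounded_adapted_bel H)
  have d_int: "integrable M (d i)" for i
    unfolding d_def
    by (rule bounded_adapted_integrable,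
        rule bounded_adapted_next[of i t "\<lambda>u x. g i x * (lik i \<theta>s u / mix i (bel (path x) t i) u - 1)"],
        rule bounded_adapted_drift_truth[OF g])
  have Y_int: "integrable M (\<lambda>x. indicator H x * Y t x)"
    unfolding Y_def
    by (intro bounded_adapted_integrable[of t] bounded_adapted_intros bounded_adapted_bel H)
  have Y_Suc: "indicator H x * Y (Suc t) x = indicator H x * Y t x + (\<Sum>i\<in>UNIV. d i x)" for x
  proof -
    have "Y (Suc t) x = Y t x + (\<Sum>i\<in>UNIV. \<pi> (Suc t) i * (A t $ i $ i * bel (path x) t i \<theta> *
        (lik i \<theta>s (\<omega> (Suc t) x i) / mix i (bel (path x) t i) (\<omega> (Suc t) x i) - 1)))"
      unfolding Y_def bel_step by (simp only: lik_eq distrib_left sum.distrib \<pi>_average)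
    then show ?thesis by (simp add: d_def g_def distrib_left sum_distrib_left mult_ac)
  qed
  have "(\<integral>x. d i x \<partial>M) = \<pi> (Suc t) i * A t $ i $ i *
          (\<integral>x. indicator H x * (bel (path x) t i \<theta> * chi2 i (bel (path x) t i)) \<partial>M)" for i
  proof -
    have "(\<integral>x. d i x \<partial>M) = (\<integral>x. g i x * chi2 i (bel (path x) t i) \<partial>M)"
      unfolding d_def by (rule drift_truth[OF g])
    also have "\<dots> = (\<integral>x. (\<pi> (Suc t) i * A t $ i $ i) * (indicator H x * (bel (path x) t i \<theta> * chi2 i (bel (path x) t i))) \<partial>M)"
      by (simp add: g_def mult_ac)
    finally show ?thesis by simp
  qed
  then show ?thesis
    unfolding Y_def[symmetric] Y_Suc by (simp add: Y_int d_int)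
qed

lemma AE_average_belief_convergent:
  assumes \<theta>: "\<theta> \<in> (\<Inter>i. equivalent_states l \<theta>s i)"
  shows "AE x in M. convergent (\<lambda>t. \<Sum>i\<in>UNIV. \<pi> t i * bel (path x) t i \<theta>)"
proof -
  define Y where "Y t x = (\<Sum>i\<in>UNIV. \<pi> t i * bel (path x) t i \<theta>)" for t x
  have Y: "bounded_adapted t (Y t)" for t
    unfolding Y_def by (intro bounded_adapted_intros bounded_adapted_bel)
  \<comment> \<open>\<open>Y\<close> is at most 1 because the weights sum to 1, so the complement is
    a nonnegative supermartingale.\<close>
  have "AE x in M. convergent (\<lambda>t. 1 - Y t x)"
  proof (rule nonneg_supermartingale_convergent)
    have Y': "bounded_adapted t (\<lambda>x. 1 - Y t x)" for t by (intro bounded_adapted_intros Y)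
    show "subalgebra M (F t)" for t by (rule subalgebra_F)
    show "sets (F t) \<subseteq> sets (F (Suc t))" for t by (rule sets_F_mono) simp
    show "(\<lambda>x. 1 - Y t x) \<in> borel_measurable (F t)" for t using Y' by (rule bounded_adaptedD)
    show "integrable M (\<lambda>x. 1 - Y t x)" for t using Y' by (rule bounded_adapted_integrable)
    show "0 \<le> 1 - Y t x" if "x \<in> space M" for t x
    proof -
      have "Y t x \<le> (\<Sum>i\<in>UNIV. \<pi> t i * 1)"
        unfolding Y_def using belD[OF admissible_path[OF that]] \<pi>_nonneg by (intro sum_mono mult_left_mono) auto
      then show ?thesis by (simp add: \<pi>_sum)
    qed
    fix t H assume H: "H \<in> sets (F t)"
    have H_int: "integrable M (indicator H :: 'a \<Rightarrow> real)"
      using bounded_adapted_integrable[OF bounded_adapted_indicator[OF H]] .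
    have HY_int: "integrable M (\<lambda>x. indicator H x * Y s x)" if "t \<le> s" for s
      using H sets_F_mono[OF that]
      by (intro bounded_adapted_integrable[of s] bounded_adapted_intros Y) auto
    have "0 \<le> (\<Sum>i\<in>UNIV. \<pi> (Suc t) i * A t $ i $ i *
          (\<integral>x. indicator H x * (bel (path x) t i \<theta> * chi2 i (bel (path x) t i)) \<partial>M))"
      using \<pi>_nonneg belD(1)[OF admissible_path] chi2_nonneg[OF prob_vector_path]
      by (intro sum_nonneg mult_nonneg_nonneg integral_nonneg_AE AE_I2) auto
    then have "(\<integral>x. indicator H x * Y t x \<partial>M) \<le> (\<integral>x. indicator H x * Y (Suc t) x \<partial>M)"
      using average_belief_drift[OF \<theta> H] by (simp add: Y_def del: belief.simps)
    then show "(\<integral>x. indicator H x * (1 - Y (Suc t) x) \<partial>M) \<le> (\<integral>x. indicator H x * (1 - Y t x) \<partial>M)"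
      by (simp add: right_diff_distrib H_int HY_int)
  qed
  then show ?thesis
  proof eventually_elim
    case (elim x)
    from convergent_diff[OF convergent_const[of 1] this] show ?case by (simp add: Y_def)
  qed
qed

text \<open>The mean of the weighted belief stays in the unit interval and rises at each step by at
  least \<open>p * \<delta>\<close> times the expected divergence of any one agent; telescoping
  gives the bound \<open>1 / (p * \<delta>)\<close>.\<close>

lemma sum_expectation_chi2_bounded:
  obtains K where "\<And>i n. (\<Sum>t<n. \<integral>x. bel (path x) t i \<theta>s * chi2 i (bel (path x) t i) \<partial>M) \<le> K"
proof -
  obtain \<delta> where \<delta>: "0 < \<delta>" "\<delta> \<le> 1" "\<And>t i j. 0 < A t $ i $ j \<Longrightarrow> \<delta> \<le> A t $ i $ j"
    "\<And>t i. \<delta> \<le> A t $ i $ i" by (fact entry_bound)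
  have \<theta>: "\<theta>s \<in> (\<Inter>i. equivalent_states l \<theta>s i)" by (simp add: equivalent_states_def)
  define E where "E t i = (\<integral>x. bel (path x) t i \<theta>s * chi2 i (bel (path x) t i) \<partial>M)" for t i
  have E_nonneg: "0 \<le> E t i" for t i
    unfolding E_def using belD(1)[OF admissible_path] chi2_nonneg[OF prob_vector_path]
    by (intro integral_nonneg_AE AE_I2 mult_nonneg_nonneg) auto
  define Y where "Y t = (\<integral>x. (\<Sum>i\<in>UNIV. \<pi> t i * bel (path x) t i \<theta>s) \<partial>M)" for t
  have space_int: "(\<integral>x. indicator (space M) x * f x \<partial>M) = (\<integral>x. f x \<partial>M)" for f :: "'a \<Rightarrow> real"
    by (intro Bochner_Integration.integral_cong) auto
  have "space M \<in> sets (F t)" for t using sets.top[of "F t"] by simp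
  from average_belief_drift[OF \<theta> this]
  have Y_Suc: "Y (Suc t) = Y t + (\<Sum>i\<in>UNIV. \<pi> (Suc t) i * A t $ i $ i * E t i)" for t
    unfolding Y_def E_def space_int .
  have Y_bounds: "0 \<le> Y t" "Y t \<le> 1" for t
  proof -
    let ?y = "\<lambda>x. \<Sum>i\<in>UNIV. \<pi> t i * bel (path x) t i \<theta>s"
    have y: "0 \<le> ?y x \<and> ?y x \<le> 1" if "x \<in> space M" for x
    proof -
      have "?y x \<le> (\<Sum>i\<in>UNIV. \<pi> t i * 1)"
        using belD[OF admissible_path[OF that]] \<pi>_nonneg by (intro sum_mono mult_left_mono) auto
      then show ?thesis
        using belD[OF admissible_path[OF that]] \<pi>_nonneg by (auto simp: \<pi>_sum intro!: sum_nonneg)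
    qed
    then show "0 \<le> Y t" unfolding Y_def by (intro integral_nonneg_AE AE_I2) auto
    have "Y t \<le> (\<integral>x. 1 \<partial>M)"
      unfolding Y_def
      by (intro integral_mono bounded_adapted_integrable[of t] bounded_adapted_intros bounded_adapted_bel) (use y in auto)
    then show "Y t \<le> 1" by (simp add: prob_space)
  qed
  have telescope: "p * \<delta> * (\<Sum>t<n. E t i) \<le> Y n - Y 0" for n i
  proof (induction n)
    case (Suc n)
    have "p * \<delta> * E n i \<le> \<pi> (Suc n) i * A n $ i $ i * E n i"
      using p_pos \<delta>(1) \<pi>_ge[of "Suc n" i] \<delta>(4)[of n i] E_nonneg
      by (intro mult_right_mono mult_mono) (auto simp: \<pi>_nonneg)
    also have "\<dots> \<le> (\<Sum>i\<in>UNIV. \<pi> (Suc n) i * A n $ i $ i * E n i)"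
      using E_nonneg \<pi>_nonneg by (intro member_le_sum[of i UNIV "\<lambda>i. \<pi> (Suc n) i * A n $ i $ i * E n i"]) auto
    finally show ?case using Suc by (simp add: Y_Suc distrib_left)
  qed simp
  have "p * \<delta> * (\<Sum>t<n. E t i) \<le> 1" for n i
    using telescope[of i n] Y_bounds(1)[of 0] Y_bounds(2)[of n] by linarith
  then have "(\<Sum>t<n. E t i) \<le> 1 / (p * \<delta>)" for n i
    using p_pos \<delta>(1) by (simp add: pos_le_divide_eq mult.commute)
  then show thesis unfolding E_def using that by blast
qed

lemma AE_chi2:
  "AE x in M. \<forall>i. (\<lambda>t. bel (path x) t i \<theta>s * chi2 i (bel (path x) t i)) \<longlonglongrightarrow> 0"
proof -
  obtain K where K: "\<And>i n. (\<Sum>t<n. \<integral>x. bel (path x) t i \<theta>s * chi2 i (bel (path x) t i) \<partial>M) \<le> K"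
    by (fact sum_expectation_chi2_bounded)
  have "AE x in M. (\<lambda>t. bel (path x) t i \<theta>s * chi2 i (bel (path x) t i)) \<longlonglongrightarrow> 0" for i
  proof (rule AE_tendsto_0_if_summable[OF _ _ K])
    show "integrable M (\<lambda>x. bel (path x) t i \<theta>s * chi2 i (bel (path x) t i))" for t
      using bounded_adapted_bel_chi2 by (rule bounded_adapted_integrable)
    show "0 \<le> bel (path x) t i \<theta>s * chi2 i (bel (path x) t i)" if "x \<in> space M" for x t
      using belD(1)[OF admissible_path[OF that]] chi2_nonneg[OF prob_vector_path[OF that]] by simp
  qed
  then show ?thesis by (simp add: AE_all_countable)
qed

text \<open>Every signal has conditional probability at least \<open>c\<close>, so the summability of the
  divergence at time \<open>Suc t\<close> passes to each hypothetical continuation.\<close>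

lemma AE_chi2_update:
  "AE x in M. \<forall>i. \<forall>u\<in>S i.
    (\<lambda>t. update t i u (bel (path x) t) \<theta>s * chi2 i (update t i u (bel (path x) t))) \<longlonglongrightarrow> 0"
proof -
  obtain c where c: "0 < c" "c \<le> 1" "\<And>i \<theta> u. u \<in> S i \<Longrightarrow> c \<le> lik i \<theta> u" by (fact lik_bound)
  obtain K where K: "\<And>i n. (\<Sum>t<n. \<integral>x. bel (path x) t i \<theta>s * chi2 i (bel (path x) t i) \<partial>M) \<le> K"
    by (fact sum_expectation_chi2_bounded)
  have "AE x in M. (\<lambda>t. update t i u (bel (path x) t) \<theta>s * chi2 i (update t i u (bel (path x) t))) \<longlonglongrightarrow> 0"
    if u: "u \<in> S i" for i u
  proof -
    let ?h = "\<lambda>t u x. update t i u (bel (path x) t) \<theta>s * chi2 i (update t i u (bel (path x) t))"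
    have pv: "prob_vector (update t i u (bel (path x) t))" if "x \<in> space M" "u \<in> S i" for t x u
      using prob_vector_path[OF that(1)] that(2) by (rule prob_vector_update)
    have h: "bounded_adapted t (?h t u)" if "u \<in> S i" for t u
      by (intro bounded_adapted_intros bounded_adapted_update bounded_adapted_chi2 that pv)
    have h_nonneg: "0 \<le> ?h t u x" if "x \<in> space M" "u \<in> S i" for t x u
      using prob_vectorD(1)[OF pv[OF that]] chi2_nonneg[OF pv[OF that]] by simp
    let ?E = "\<lambda>t. \<integral>x. bel (path x) t i \<theta>s * chi2 i (bel (path x) t i) \<partial>M"
    have E_nonneg: "0 \<le> ?E t" for t
      using belD(1)[OF admissible_path] chi2_nonneg[OF prob_vector_path]
      by (intro integral_nonneg_AE AE_I2 mult_nonneg_nonneg) auto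
    have step: "c * (\<integral>x. ?h t u x \<partial>M) \<le> ?E (Suc t)" for t
    proof -
      have I_nonneg: "0 \<le> (\<integral>x. ?h t v x \<partial>M)" if "v \<in> S i" for v
        using h_nonneg that by (intro integral_nonneg_AE AE_I2) auto
      have "c * (\<integral>x. ?h t u x \<partial>M) \<le> lik i \<theta>s u * (\<integral>x. ?h t u x \<partial>M)"
        using c(3)[OF u] I_nonneg[OF u] by (intro mult_right_mono) auto
      also have "\<dots> \<le> (\<Sum>v\<in>S i. lik i \<theta>s v * (\<integral>x. ?h t v x \<partial>M))"
        using u finite_S I_nonneg
        by (intro member_le_sum[of u "S i" "\<lambda>v. lik i \<theta>s v * (\<integral>x. ?h t v x \<partial>M)"]) auto
      also have "\<dots> = (\<integral>x. ?h t (\<omega> (Suc t) x i) x \<partial>M)"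
        by (rule expectation_next[symmetric]) (rule h)
      also have "\<dots> = ?E (Suc t)" unfolding belief_Suc ..
      finally show ?thesis .
    qed
    have "c * (\<Sum>t<n. \<integral>x. ?h t u x \<partial>M) \<le> K" for n
    proof -
      have "c * (\<Sum>t<n. \<integral>x. ?h t u x \<partial>M) \<le> (\<Sum>t<n. ?E (Suc t))"
        unfolding sum_distrib_left by (intro sum_mono step)
      also have "\<dots> \<le> ?E 0 + (\<Sum>t<n. ?E (Suc t))" using E_nonneg[of 0] by linarith
      also have "\<dots> = (\<Sum>t<Suc n. ?E t)" by (rule sum.lessThan_Suc_shift[symmetric])
      also have "\<dots> \<le> K" by (rule K)
      finally show ?thesis .
    qed
    then have "(\<Sum>t<n. \<integral>x. ?h t u x \<partial>M) \<le> K / c" for n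
      using c(1) by (simp add: pos_le_divide_eq mult.commute)
    then show ?thesis
      using bounded_adapted_integrable[OF h[OF u]] h_nonneg[OF _ u] by (intro AE_tendsto_0_if_summable) auto
  qed
  then show ?thesis by (simp add: AE_all_countable AE_ball_countable countable_finite finite_S)
qed

end

section \<open>Almost sure limits of the beliefs\<close>

theorem AE_bel_vanishes:
  "AE x in M. \<forall>i \<theta>. \<theta> \<notin> equivalent_states l \<theta>s i \<longrightarrow> (\<lambda>t. bel (path x) t i \<theta>) \<longlonglongrightarrow> 0"
proof -
  obtain p \<pi> where \<pi>: "0 < p" "\<And>t i. p \<le> \<pi> t i" "\<And>t. (\<Sum>i\<in>UNIV. \<pi> t i) = 1"
    "\<And>t j. \<pi> t j = (\<Sum>i\<in>UNIV. \<pi> (Suc t) i * A t $ i $ j)" by (fact absolute_probability_sequence)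
  show ?thesis
    using AE_truth_bounded_below[OF \<pi>] AE_chi2[OF \<pi>] AE_chi2_update[OF \<pi>] AE_space
  proof eventually_elim
    case (elim x)
    obtain \<epsilon> where \<epsilon>: "0 < \<epsilon>" "\<forall>\<^sub>F t in sequentially. \<forall>j. \<epsilon> \<le> bel (path x) t j \<theta>s"
      using elim(1) by blast
    show ?case
      using bel_vanishes[OF admissible_path[OF elim(4)] \<epsilon>] elim(2,3) by blast
  qed
qed

theorem AE_bel_converges:
  "AE x in M. \<exists>C. \<forall>i. (\<lambda>t. bel (path x) t i \<theta>) \<longlonglongrightarrow> C"
proof (cases "\<theta> \<in> (\<Inter>i. equivalent_states l \<theta>s i)")
  case False
  then obtain j where j: "\<theta> \<notin> equivalent_states l \<theta>s j" by auto
  show ?thesis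
    using AE_bel_vanishes AE_space
  proof eventually_elim
    case (elim x)
    then have "(\<lambda>t. bel (path x) t j \<theta>) \<longlonglongrightarrow> 0" using j by blast
    then show ?case using bel_vanishes_everywhere[OF admissible_path[OF elim(2)]] by blast
  qed
next
  case True
  obtain p \<pi> where \<pi>: "0 < p" "\<And>t i. p \<le> \<pi> t i" "\<And>t. (\<Sum>i\<in>UNIV. \<pi> t i) = 1"
    "\<And>t j. \<pi> t j = (\<Sum>i\<in>UNIV. \<pi> (Suc t) i * A t $ i $ j)" by (fact absolute_probability_sequence)
  show ?thesis
    using AE_truth_bounded_below[OF \<pi>] AE_chi2[OF \<pi>] AE_average_belief_convergent[OF \<pi> True] AE_space
  proof eventually_elim
    case (elim x)
    obtain \<epsilon> where \<epsilon>: "0 < \<epsilon>" "\<forall>\<^sub>F t in sequentially. \<forall>j. \<epsilon> \<le> bel (path x) t j \<theta>s"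
      using elim(1) by blast
    have cons: "(\<lambda>t. bel (path x) t i \<theta> - bel (path x) t j \<theta>) \<longlonglongrightarrow> 0" for i j
      using bel_consensus[OF admissible_path[OF elim(4)] \<epsilon> _ True] elim(2) by blast
    obtain C where C: "(\<lambda>t. \<Sum>i\<in>UNIV. \<pi> t i * bel (path x) t i \<theta>) \<longlonglongrightarrow> C"
      using elim(3) by (auto simp: convergent_def)
    have "(\<lambda>t. bel (path x) t i \<theta>) \<longlonglongrightarrow> C" for i
    proof -
      \<comment> \<open>Since the weights sum to 1, this is the belief of \<open>i\<close> minus the
        weighted mean, written through the vanishing disagreements.\<close>
      have "(\<lambda>t. \<Sum>j\<in>UNIV. \<pi> t j * (bel (path x) t i \<theta> - bel (path x) t j \<theta>)) \<longlonglongrightarrow> 0"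
      proof (rule tendsto_null_sum, rule Lim_null_comparison)
        fix j
        show "(\<lambda>t. \<bar>bel (path x) t i \<theta> - bel (path x) t j \<theta>\<bar>) \<longlonglongrightarrow> 0"
          using cons by (rule tendsto_rabs_zero)
        have "\<bar>\<pi> t j\<bar> \<le> 1" for t
          using member_le_sum[of j UNIV "\<pi> t"] \<pi>(1) \<pi>(2)[of t] \<pi>(3)[of t] by (smt (verit) UNIV_I finite)
        then show "\<forall>\<^sub>F t in sequentially. norm (\<pi> t j * (bel (path x) t i \<theta> - bel (path x) t j \<theta>))
            \<le> \<bar>bel (path x) t i \<theta> - bel (path x) t j \<theta>\<bar>"
          by (simp add: abs_mult mult_left_le_one_le)
      qed
      from tendsto_add[OF this C] show ?thesis
        by (simp add: right_diff_distrib sum_subtractf \<pi>(3) flip: sum_distrib_right)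
    qed
    then show ?case by blast
  qed
qed

end

theorem corollary4:
  fixes M :: "'a measure"
    and S :: "'n::finite \<Rightarrow> 's set"
    and l :: "'th::finite \<Rightarrow> ('n \<Rightarrow> 's) pmf"
    and \<theta>s :: 'th
    and \<omega> :: "nat \<Rightarrow> 'a \<Rightarrow> 'n \<Rightarrow> 's"
    and A :: "nat \<Rightarrow> real^'n^'n"
    and \<mu>0 :: "'n \<Rightarrow> 'th pmf"
    and j0 :: 'n
  assumes "prob_space M"
    and "\<And>i. finite (S i)"
    and "\<And>\<theta>. set_pmf (l \<theta>) \<subseteq> {s. \<forall>i. s i \<in> S i}"
    and "\<And>i s \<theta>. s \<in> S i \<Longrightarrow> pmf (marginal l i \<theta>) s > 0"
    and "\<And>t x i. t \<ge> 1 \<Longrightarrow> x \<in> space M \<Longrightarrow> \<omega> t x i \<in> S i"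
    and "prob_space.indep_vars M (\<lambda>_. count_space UNIV) \<omega> {1..}"
    and "\<And>t. t \<ge> 1 \<Longrightarrow> distr M (count_space UNIV) (\<omega> t) = measure_pmf (l \<theta>s)"
    and "\<And>t. stochastic_matrix (A t)"
    and "pmf (\<mu>0 j0) \<theta>s > 0"
    and "uniformly_strongly_connected A"
  shows "(AE x in M. \<forall>i. weakly_merges S l \<theta>s (belief l A \<mu>0 (\<lambda>t. \<omega> t x)) i) \<and>
    (\<forall>\<theta>. \<exists>C \<in> borel_measurable M. (\<forall>x\<in>space M. C x \<in> {0..1::real}) \<and>
       (AE x in M. \<forall>i. (\<lambda>t. belief l A \<mu>0 (\<lambda>t. \<omega> t x) t i \<theta>) \<longlonglongrightarrow> C x)) \<and>
    (identifiable l \<theta>s \<longrightarrow>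
       (AE x in M. \<forall>i. asymptotically_learns \<theta>s (belief l A \<mu>0 (\<lambda>t. \<omega> t x)) i))"
proof -
  interpret prob_space M by fact
  interpret learning_signals A S l \<theta>s \<mu>0 j0 M \<omega>
    by unfold_locales (use assms in auto)
  have "AE x in M. \<forall>i. weakly_merges S l \<theta>s (bel (path x)) i"
    using AE_bel_vanishes AE_space
    by eventually_elim (auto intro!: weakly_merges_if_vanishes admissible_path)
  moreover have "AE x in M. \<forall>i. asymptotically_learns \<theta>s (bel (path x)) i" if "identifiable l \<theta>s"
    using AE_bel_vanishes AE_space
    by eventually_elim (use that in \<open>auto intro!: learns_if_vanishes admissible_path\<close>)
  moreover have "\<exists>C \<in> borel_measurable M. (\<forall>x\<in>space M. C x \<in> {0..1::real}) \<and>
       (AE x in M. \<forall>i. (\<lambda>t. bel (path x) t i \<theta>) \<longlonglongrightarrow> C x)" for \<theta>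
  proof (intro bexI conjI ballI)
    \<comment> \<open>By consensus any agent could supply the limit. Clamping keeps the value in the
      unit interval also on the null set where the limit may fail to exist.\<close>
    let ?C = "\<lambda>x. max 0 (min 1 (lim (\<lambda>t. bel (path x) t j0 \<theta>)))"
    have [measurable]: "(\<lambda>x. bel (path x) t j0 \<theta>) \<in> borel_measurable M" for t
      using measurable_F_M[OF bounded_adaptedD[OF bounded_adapted_bel]] .
    show "?C \<in> borel_measurable M" by measurable
    show "?C x \<in> {0..1}" for x by simp
    show "AE x in M. \<forall>i. (\<lambda>t. bel (path x) t i \<theta>) \<longlonglongrightarrow> ?C x"
      using AE_bel_converges[of \<theta>] AE_space
    proof eventually_elim
      case (elim x)
      then obtain C where C: "\<And>i. (\<lambda>t. bel (path x) t i \<theta>) \<longlonglongrightarrow> C" by blast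
      have "0 \<le> C" by (rule LIMSEQ_le_const[OF C[of j0]]) (simp add: belD[OF admissible_path[OF elim(2)]])
      moreover have "C \<le> 1" by (rule LIMSEQ_le_const2[OF C[of j0]]) (simp add: belD[OF admissible_path[OF elim(2)]])
      ultimately have "?C x = C" using limI[OF C[of j0]] by simp
      then show ?case using C by simp
    qed
  qed
  ultimately show ?thesis by blast
qed

end
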